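(* Let $\Omega\subset\mathbb{R}^\nu$, $g$, $f$, $\lambda$, the value function $u$, the family of triangulations and the fully discrete solution $u_k^h$ be as in the context; in particular $g$ and $f$ are bounded and Lipschitz with constants $M_g,L_g$ and $M_f,L_f$, and the triangulations satisfy properties (T1)–(T5) listed there. Then there exists a constant $M$, independent of the discretization parameters $h$ and $k$, such that for all admissible $h,k$, all $x\in\Omega_k$ and all $a\in I_h$: (i) if $L_g<\lambda$, then $|u(x,a)-u_k^h(x,a)|\le M\left(h+\frac{k}{\sqrt h}\right)$; (ii) if $L_g>\lambda$, then $|u(x,a)-u_k^h(x,a)|\le M\left(h+\frac{k}{\sqrt h}\right)^{\gamma}$ with $\gamma=\frac{\lambda}{L_g}$; (iii) if $L_g=\lambda$, then for any $\gamma\in(0,1)$ (with $M$ allowed to depend on $\gamma$), $|u(x,a)-u_k^h(x,a)|\le M\left(h+\frac{k}{\sqrt h}\right)^{\gamma}$.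
   Context: Continuous problem. $\Omega\subset\mathbb{R}^\nu$ is open, $\lambda>0$, $g:\Omega\times[0,1]\to\mathbb{R}^\nu$ and $f:\Omega\times[0,1]\to\mathbb{R}$ satisfy, for positive constants $L_g,M_g,L_f,M_f$ and all $x,\bar x\in\Omega$, $a,\bar a\in[0,1]$: $\|g(x,a)-g(\bar x,\bar a)\|\le L_g(\|x-\bar x\|+|a-\bar a|)$, $\|g(x,a)\|\le M_g$, $|f(x,a)-f(\bar x,\bar a)|\le L_f(\|x-\bar x\|+|a-\bar a|)$, $|f(x,a)|\le M_f$. For $a\in[0,1]$, $\mathcal{A}(a)$ is the set of non-decreasing functions $\alpha:[0,+\infty)\to[0,1]$ with $\alpha(0)\ge a$. For $x\in\Omega$ and $\alpha\in\mathcal{A}(a)$, $y$ solves $\dot y(s)=g(y(s),\alpha(s))$, $s>0$, $y(0)=x$; it is assumed that $y(s)$ stays in $\Omega$ for every control. The value function is $u(x,a)=\inf_{\alpha\in\mathcal{A}(a)}\int_0^\infty f(y(s),\alpha(s))e^{-\lambda s}\,ds$. Discretization. $h>0$ with $1/h$ an integer, $I_h=\{ih: i=0,\dots,1/h\}$, $I_h(a)=I_h\cap[a,1]$. For each $k$ one has a triangulation $\{S_j^k\}_j$ by simplices, with $\Omega_k=\bigcup_j S_j^k$ a polyhedron, such that: (T1) $\max_j \operatorname{diam}S_j^k=k$; (T2) there is $h_0>0$ (independent of $k$) such that $x+hg(x,a)\in\Omega_k$ for all $x\in\Omega_k$, $a\in I_h$, $0<h<h_0$; (T3) $\Omega_k\subset\Omega$,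 and for every compact $K\subset\Omega$ there is $\bar k(K)$ with $K\subset\Omega_k$ for all $k\le\bar k(K)$; (T4) there is $\chi_1>0$ (independent of the discretization) such that each simplex $S_i^k$, of diameter $d_i$, contains in its interior a sphere of radius $r\ge\chi_1 d_i$; (T5) there is $\chi_2$ (independent of the discretization) with $k/d_i\le\chi_2$ for all $i$. $V^k=\{x^i: i=1,\dots,N\}$ is the set of vertices of the simplices. $W_k$ is the set of functions $w:\Omega_k\times I_h\to\mathbb{R}$ such that $w(\cdot,a)$ is continuous on $\Omega_k$ and affine on each simplex; such $w$ is determined by its values $w(x^i,a)$. The operator $A_k^h:W_k\to W_k$ is defined by $$(A_k^hw)(x^i,a)=\min_{b\in I_h(a)}\{(1-\lambda h)\,w(x^i+hg(x^i,a),b)+hf(x^i,a)\},\quad x^i\in V^k,\ a\in I_h .$$ Parameters are admissible when $0<h<\min(h_0,1/\lambda)$ and $1/h$ is an integer; then $A_k^h$ is a contraction for the max norm over vertices and $I_h$, and $u_k^h\in W_k$ denotes its unique fixed point. "Independent of $h,k$" means that the constant depends only on the data $\lambda,M_g,M_f,L_g,L_f,\nu$ and the constants of (T2), (T4), (T5) (and on $\gamma$ in the case $L_g=\lambda$). *)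

theory Defs
  imports "HOL-Analysis.Analysis" "HOL-Library.FuncSet"
begin

definition bounded_lipschitz ::
  "(real^'n) set \<Rightarrow> real \<Rightarrow> real \<Rightarrow> (real^'n \<Rightarrow> real \<Rightarrow> 'b::real_normed_vector) \<Rightarrow> bool" where
  "bounded_lipschitz \<Omega> L B F \<longleftrightarrow>
     (\<forall>x\<in>\<Omega>. \<forall>x'\<in>\<Omega>. \<forall>a\<in>{0..1}. \<forall>a'\<in>{0..1}.
        norm (F x a - F x' a') \<le> L * (norm (x - x') + \<bar>a - a'\<bar>)) \<and>
     (\<forall>x\<in>\<Omega>. \<forall>a\<in>{0..1}. norm (F x a) \<le> B)"

definition controls :: "real \<Rightarrow> (real \<Rightarrow> real) set" where
  "controls a = {\<alpha>. mono_on {0..} \<alpha> \<and> \<alpha> \<in> {0..} \<rightarrow> {0..1} \<and> a \<le> \<alpha> 0}"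

text \<open>
  Controls may jump, so the equation \<open>y' = g(y,\<alpha>)\<close>, \<open>y(0) = x\<close> is meant in the sense of
  Caratheodory, i.e. as an integral equation.  As \<open>g\<close> is only given on \<open>\<Omega>\<close>, staying in \<open>\<Omega>\<close> is
  part of being a trajectory.
\<close>

definition trajectory ::
  "(real^'n) set \<Rightarrow> (real^'n \<Rightarrow> real \<Rightarrow> real^'n) \<Rightarrow> real^'n \<Rightarrow> (real \<Rightarrow> real) \<Rightarrow> (real \<Rightarrow> real^'n) \<Rightarrow> bool"
  where
  "trajectory \<Omega> g x \<alpha> y \<longleftrightarrow>
     y 0 = x \<and> continuous_on {0..} y \<and> (\<forall>s\<ge>0. y s \<in> \<Omega>) \<and>
     (\<forall>s\<ge>0. ((\<lambda>r. g (y r) (\<alpha> r)) has_integral (y s - x)) {0..s})"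

definition control_problem ::
  "(real^'n) set \<Rightarrow> (real^'n \<Rightarrow> real \<Rightarrow> real^'n) \<Rightarrow> (real^'n \<Rightarrow> real \<Rightarrow> real) \<Rightarrow>
   real \<Rightarrow> real \<Rightarrow> real \<Rightarrow> real \<Rightarrow> bool" where
  "control_problem \<Omega> g f L\<^sub>g M\<^sub>g L\<^sub>f M\<^sub>f \<longleftrightarrow>
     open \<Omega> \<and> bounded_lipschitz \<Omega> L\<^sub>g M\<^sub>g g \<and> bounded_lipschitz \<Omega> L\<^sub>f M\<^sub>f f \<and>
     (\<forall>x\<in>\<Omega>. \<forall>a\<in>{0..1}. \<forall>\<alpha>\<in>controls a. \<exists>y. trajectory \<Omega> g x \<alpha> y)"

text \<open>
  For each control the trajectory is unique on \<open>{0..}\<close> by the Lipschitz condition, so taking the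
  infimum over pairs \<open>(\<alpha>, y)\<close> is the infimum over controls.
\<close>

definition value_function ::
  "(real^'n) set \<Rightarrow> (real^'n \<Rightarrow> real \<Rightarrow> real^'n) \<Rightarrow> (real^'n \<Rightarrow> real \<Rightarrow> real) \<Rightarrow> real \<Rightarrow>
   real^'n \<Rightarrow> real \<Rightarrow> real" where
  "value_function \<Omega> g f lam x a =
     Inf {integral {0..} (\<lambda>s. f (y s) (\<alpha> s) * exp (- lam * s)) | \<alpha> y.
            \<alpha> \<in> controls a \<and> trajectory \<Omega> g x \<alpha> y}"

definition grid :: "real \<Rightarrow> real set" where
  "grid h = {real i * h | i::nat. real i \<le> 1 / h}"

definition grid_from :: "real \<Rightarrow> real \<Rightarrow> real set" where
  "grid_from h a = grid h \<inter> {a..1}"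

definition vertices :: "(real^'n) set set \<Rightarrow> (real^'n) set" where
  "vertices \<T> = {v. \<exists>S\<in>\<T>. v extreme_point_of S}"

text \<open>
  The family of triangulations \<open>T k\<close> is indexed by a set \<open>\<K>\<close> of mesh sizes.  It cannot be indexed
  by all \<open>k > 0\<close>: if \<open>\<Omega>\<close> is bounded, large values of \<open>k\<close> are not the diameter of a simplex in
  \<open>\<Omega>\<close>.  The polyhedron \<open>\<Omega>\<^sub>k = \<Union>(T k)\<close> need not be convex.
\<close>

definition mesh_family ::
  "(real^'n) set \<Rightarrow> (real^'n \<Rightarrow> real \<Rightarrow> real^'n) \<Rightarrow> real \<Rightarrow> real \<Rightarrow> real \<Rightarrow>
   real set \<Rightarrow> (real \<Rightarrow> (real^'n) set set) \<Rightarrow> bool" where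
  "mesh_family \<Omega> g h\<^sub>0 \<chi>\<^sub>1 \<chi>\<^sub>2 \<K> T \<longleftrightarrow>
     (\<forall>k\<in>\<K>. k > 0 \<and> T k \<noteq> {} \<and> triangulation (T k) \<and>
        (\<forall>S\<in>T k. int CARD('n) simplex S)) \<and>
     (\<forall>k\<in>\<K>. Max (diameter ` T k) = k) \<and>
     (\<forall>k\<in>\<K>. \<forall>h. 0 < h \<and> h < h\<^sub>0 \<and> 1 / h \<in> \<int> \<longrightarrow>
        (\<forall>x\<in>\<Union>(T k). \<forall>a\<in>grid h. x + h *\<^sub>R g x a \<in> \<Union>(T k))) \<and>
     (\<forall>k\<in>\<K>. \<Union>(T k) \<subseteq> \<Omega>) \<and>
     (\<forall>K. compact K \<and> K \<subseteq> \<Omega> \<longrightarrow> (\<exists>kbar>0. \<forall>k\<in>\<K>. k \<le> kbar \<longrightarrow> K \<subseteq> \<Union>(T k))) \<and>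
     (\<forall>k\<in>\<K>. \<forall>S\<in>T k. \<exists>c r. r \<ge> \<chi>\<^sub>1 * diameter S \<and> sphere c r \<subseteq> interior S) \<and>
     (\<forall>k\<in>\<K>. \<forall>S\<in>T k. k / diameter S \<le> \<chi>\<^sub>2)"

text \<open>
  Functions on \<open>\<Omega>\<^sub>k \<times> I\<^sub>h\<close> are encoded as extensional functions, so that elements of the finite
  element space are determined by their vertex values also as HOL functions.
\<close>

definition fe_space :: "(real^'n) set set \<Rightarrow> real \<Rightarrow> ((real^'n) \<times> real \<Rightarrow> real) set" where
  "fe_space \<T> h =
     {w \<in> extensional (\<Union>\<T> \<times> grid h).
        \<forall>a\<in>grid h. continuous_on (\<Union>\<T>) (\<lambda>x. w (x, a)) \<and>
          (\<forall>S\<in>\<T>. \<exists>p q. \<forall>x\<in>S. w (x, a) = p \<bullet> x + q)}"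

definition scheme_op ::
  "(real^'n \<Rightarrow> real \<Rightarrow> real^'n) \<Rightarrow> (real^'n \<Rightarrow> real \<Rightarrow> real) \<Rightarrow> real \<Rightarrow>
   (real^'n) set set \<Rightarrow> real \<Rightarrow> ((real^'n) \<times> real \<Rightarrow> real) \<Rightarrow> ((real^'n) \<times> real \<Rightarrow> real)" where
  "scheme_op g f lam \<T> h w =
     (THE w'. w' \<in> fe_space \<T> h \<and>
        (\<forall>x\<in>vertices \<T>. \<forall>a\<in>grid h.
           w' (x, a) = (MIN b\<in>grid_from h a. (1 - lam * h) * w (x + h *\<^sub>R g x a, b) + h * f x a)))"

definition discrete_solution ::
  "(real^'n \<Rightarrow> real \<Rightarrow> real^'n) \<Rightarrow> (real^'n \<Rightarrow> real \<Rightarrow> real) \<Rightarrow> real \<Rightarrow>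
   (real^'n) set set \<Rightarrow> real \<Rightarrow> ((real^'n) \<times> real \<Rightarrow> real)" where
  "discrete_solution g f lam \<T> h = (THE w. w \<in> fe_space \<T> h \<and> scheme_op g f lam \<T> h w = w)"

definition admissible_step :: "real \<Rightarrow> real \<Rightarrow> real \<Rightarrow> bool" where
  "admissible_step h\<^sub>0 lam h \<longleftrightarrow> 0 < h \<and> h < min h\<^sub>0 (1 / lam) \<and> 1 / h \<in> \<int>"

end

theory Submission
  imports Defs
begin

text \<open>
  Linear interpolation on the simplices makes the fully discrete equation the dynamic programming
  equation of a controlled Markov chain: an Euler step followed by a jump to a random vertex of the
  simplex, with the barycentric coordinates as probabilities.  The jumps are centred and have
  variance at most \<open>k\<^sup>2\<close>, so along \<open>t / h\<close> steps they accumulate in mean square only to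
  \<open>k\<^sup>2 / h\<close>, amplified by \<open>exp (2 L\<^sub>g t)\<close>.  Hence the chain differs from the deterministic Euler
  path with the same controls by \<open>k / sqrt h\<close> rather than \<open>k / h\<close>.
  The Euler path differs from the exact trajectory by \<open>h\<close>, because monotone controls have total
  variation at most 1.  Both errors are integrated against \<open>exp (- lam t)\<close> up to a horizon
  that is chosen according to the sign of \<open>L\<^sub>g - lam\<close>; the case \<open>L\<^sub>g = lam\<close> follows from the case
  \<open>L\<^sub>g > lam\<close> by enlarging the Lipschitz constant to \<open>lam / \<gamma>\<close>.
\<close>

section \<open>Barycentric interpolation on a triangulation\<close>

text \<open>Estimating the interpolation error separately in each step would charge an error of
  order \<open>k\<close> in every one of about t / h steps, and no smoothness of the value function
  is at hand to improve this. The centring of the jumps is exploited instead through the comparison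
  function \<open>sqrt ((norm (x - y))\<^sup>2 + noise)\<close>. It dominates the distance and is
  concave in the squared distance, so by Jensen a mean over the weights only adds
  \<open>k\<^sup>2\<close> under the root. The constant \<open>noise\<close> solves
  \<open>k\<^sup>2 + noise = \<rho>\<^sup>2 * noise\<close>; hence an Euler step followed by a jump
  multiplies the comparison function by at most \<open>\<rho>\<close>, just as a deterministic step
  multiplies the distance. No probability space and no paths of the chain are needed: one induction
  over the number of steps suffices. The number \<open>m\<close> of steps stays free until the end,
  because for \<open>lam < L\<^sub>g\<close> the accumulated error grows with the horizon and has to
  be balanced against truncation.\<close>

lemma affine_interpolation:
  fixes C :: "'a::euclidean_space set"
  assumes "\<not> affine_dependent C"
  obtains p q where "\<And>c. c \<in> C \<Longrightarrow> p \<bullet> c + q = \<phi> c"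
proof (cases "C = {}")
  case True
  then show ?thesis using that by auto
next
  case False
  then obtain c0 where c0: "c0 \<in> C" by auto
  let ?B = "(\<lambda>x. -c0 + x) ` (C - {c0})"
  have "independent ?B"
    using assms affine_dependent_iff_dependent2[OF c0] by auto
  then obtain L where L: "linear L" "\<forall>b\<in>?B. L b = \<phi> (b + c0) - \<phi> c0"
    using linear_independent_extend[of ?B "\<lambda>b. \<phi> (b + c0) - \<phi> c0"] by auto
  have Lp: "L x = adjoint L 1 \<bullet> x" for x
    using adjoint_works[OF L(1), of x 1] by (simp add: inner_commute)
  have "adjoint L 1 \<bullet> c + (\<phi> c0 - L c0) = \<phi> c" if "c \<in> C" for c
  proof (cases "c = c0")
    case True
    then show ?thesis by (simp add: Lp)
  next
    case False
    then have "L (-c0 + c) = \<phi> c - \<phi> c0" using L(2) that by force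
    moreover have "L (-c0 + c) = L c - L c0"
      using L(1) by (simp add: linear_diff)
    ultimately show ?thesis by (simp add: Lp)
  qed
  then show ?thesis using that by blast
qed

lemma sum_affine_combination:
  fixes p :: "'a::real_inner"
  assumes "sum \<mu> V = 1"
  shows "(\<Sum>v\<in>V. \<mu> v * (p \<bullet> v + q)) = p \<bullet> (\<Sum>v\<in>V. \<mu> v *\<^sub>R v) + q"
proof -
  have "(\<Sum>v\<in>V. \<mu> v * (p \<bullet> v + q)) = (\<Sum>v\<in>V. p \<bullet> (\<mu> v *\<^sub>R v)) + sum \<mu> V * q"
    by (simp add: sum_distrib_left sum.distrib[symmetric] algebra_simps)
  then show ?thesis using assms by (simp add: inner_sum_right)
qed

text \<open>Unless \<open>w\<close> carries all the weight, the combination lies between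
  \<open>w\<close> and the mean of the remaining points, and the defining property of a face pulls
  \<open>w\<close> into \<open>F\<close>. Only points of nonzero weight have to lie in
  \<open>S\<close>, since \<open>V\<close> will be the vertex set of the whole mesh.\<close>

lemma face_contains_support:
  assumes "F face_of S" "finite V" "\<And>v. v \<in> V \<Longrightarrow> \<mu> v \<noteq> 0 \<Longrightarrow> v \<in> S" "\<And>v. v \<in> V \<Longrightarrow> 0 \<le> \<mu> v"
    and "sum \<mu> V = 1" "(\<Sum>v\<in>V. \<mu> v *\<^sub>R v) \<in> F" "w \<in> V" "\<mu> w \<noteq> 0" "convex S"
  shows "w \<in> F"
proof (cases "\<mu> w = 1")
  case True
  have "sum \<mu> (V - {w}) = 0"
    using assms by (simp add: sum_diff1 True)
  then have z: "\<forall>v\<in>V - {w}. \<mu> v = 0"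
    using assms by (subst (asm) sum_nonneg_eq_0_iff) auto
  have "(\<Sum>v\<in>V. \<mu> v *\<^sub>R v) = \<mu> w *\<^sub>R w + (\<Sum>v\<in>V - {w}. \<mu> v *\<^sub>R v)"
    using assms by (simp add: sum.remove)
  also have "\<dots> = w" using z True by simp
  finally show ?thesis using assms by simp
next
  case False
  let ?m = "1 - \<mu> w"
  have s: "sum \<mu> (V - {w}) = ?m" using assms by (simp add: sum_diff1)
  have m: "?m > 0"
  proof -
    have "sum \<mu> (V - {w}) \<ge> 0" using assms by (intro sum_nonneg) auto
    then show ?thesis using s False by auto
  qed
  define z where "z = (\<Sum>v\<in>V - {w}. (\<mu> v / ?m) *\<^sub>R v)"
  have zeq: "(\<Sum>v\<in>V. \<mu> v *\<^sub>R v) = \<mu> w *\<^sub>R w + ?m *\<^sub>R z"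
    using assms m by (simp add: sum.remove z_def scaleR_right.sum)
  \<comment> \<open>Membership in \<open>S\<close> is known only where the weight is nonzero, so the
    sum is cut down to the support before convexity is used.\<close>
  have z2: "z = (\<Sum>v\<in>{v\<in>V - {w}. \<mu> v \<noteq> 0}. (\<mu> v / ?m) *\<^sub>R v)"
    unfolding z_def using assms by (intro sum.mono_neutral_right) auto
  have s2: "(\<Sum>v\<in>{v\<in>V - {w}. \<mu> v \<noteq> 0}. \<mu> v / ?m) = 1"
  proof -
    have "(\<Sum>v\<in>{v\<in>V - {w}. \<mu> v \<noteq> 0}. \<mu> v / ?m) = (\<Sum>v\<in>V - {w}. \<mu> v / ?m)"
      using assms by (intro sum.mono_neutral_left) auto
    also have "\<dots> = 1" using s m by (simp add: sum_divide_distrib[symmetric])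
    finally show ?thesis .
  qed
  have "z \<in> S"
    unfolding z2
    by (rule convex_sum[OF _ \<open>convex S\<close> s2]) (use assms m in auto)
  have wS: "w \<in> S" using assms by auto
  have "w = z \<Longrightarrow> w \<in> F"
    using zeq assms by (simp add: scaleR_add_left[symmetric])
  moreover have "w \<in> F" if "w \<noteq> z"
  proof -
    have "(\<Sum>v\<in>V. \<mu> v *\<^sub>R v) \<in> open_segment w z"
      unfolding in_segment using that zeq m assms(4)[OF \<open>w \<in> V\<close>] assms(8)
      by (auto intro!: exI[of _ "?m"])
    then show ?thesis
      using assms(1,6) wS \<open>z \<in> S\<close> unfolding face_of_def by blast
  qed
  ultimately show ?thesis by blast
qed

text \<open>Summing over all vertices of the mesh gives the weights of different points one common
  finite index set; the last conjunct confines the support to a single simplex containing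
  \<open>x\<close>.\<close>

definition barycentric :: "(real^'n) set set \<Rightarrow> real^'n \<Rightarrow> (real^'n \<Rightarrow> real) \<Rightarrow> bool" where
  "barycentric \<T> x \<mu> \<longleftrightarrow> (\<forall>v. 0 \<le> \<mu> v) \<and> sum \<mu> (vertices \<T>) = 1 \<and>
     (\<Sum>v\<in>vertices \<T>. \<mu> v *\<^sub>R v) = x \<and>
     (\<exists>S\<in>\<T>. x \<in> S \<and> (\<forall>v. \<mu> v \<noteq> 0 \<longrightarrow> v extreme_point_of S))"

definition weight :: "(real^'n) set set \<Rightarrow> real^'n \<Rightarrow> real^'n \<Rightarrow> real" where
  "weight \<T> x = (SOME \<mu>. barycentric \<T> x \<mu>)"

text \<open>\<open>simplex\<close> only asserts that some affinely independent generating set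
  exists; its identification with the extreme points justifies the definition of
  \<open>vertices\<close>.\<close>

lemma simplex_extreme_points:
  assumes "n simplex S"
  shows "\<not> affine_dependent {v. v extreme_point_of S}" "S = convex hull {v. v extreme_point_of S}"
proof -
  obtain C where "\<not> affine_dependent C" "S = convex hull C"
    using assms unfolding simplex_def by auto
  moreover from this have "{v. v extreme_point_of S} = C"
    by (auto simp: extreme_point_of_convex_hull_affine_independent)
  ultimately show "\<not> affine_dependent {v. v extreme_point_of S}"
    "S = convex hull {v. v extreme_point_of S}" by auto
qed

locale mesh =
  fixes \<T> :: "(real^'n) set set" and k :: real
  assumes triangulation: "triangulation \<T>"
    and diameter_le: "S \<in> \<T> \<Longrightarrow> diameter S \<le> k"
begin

abbreviation "V \<equiv> vertices \<T>"
abbreviation "D \<equiv> \<Union>\<T>"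

lemma simplexE: assumes "S \<in> \<T>" obtains n where "n simplex S"
  using assms triangulation unfolding triangulation_def by blast

lemma extreme_points_finite: "S \<in> \<T> \<Longrightarrow> finite {v. v extreme_point_of S}"
  using simplexE[of S] simplex_extreme_points(1) aff_independent_finite by metis

lemma vertices_eq: "V = (\<Union>S\<in>\<T>. {v. v extreme_point_of S})"
  unfolding vertices_def by auto

lemma finite_vertices: "finite V"
  using extreme_points_finite triangulation unfolding vertices_eq triangulation_def by auto

lemma vertices_subset: "V \<subseteq> D"
  unfolding vertices_def extreme_point_of_def by auto

lemma barycentric_exists:
  assumes "x \<in> D" shows "\<exists>\<mu>. barycentric \<T> x \<mu>"
proof -
  obtain S where S: "S \<in> \<T>" "x \<in> S" using assms by auto
  then obtain n where "n simplex S" using simplexE by blast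
  note sx = simplex_extreme_points[OF this]
  let ?C = "{v. v extreme_point_of S}"
  have "x \<in> convex hull ?C" using sx S by simp
  then obtain u where u: "\<And>v. v \<in> ?C \<Longrightarrow> 0 \<le> u v" "sum u ?C = 1" "(\<Sum>v\<in>?C. u v *\<^sub>R v) = x"
    unfolding convex_hull_finite[OF extreme_points_finite[OF S(1)]] by auto
  let ?\<mu> = "\<lambda>v. if v \<in> ?C then u v else 0"
  have CV: "?C \<subseteq> V" using S by (auto simp: vertices_def)
  have "sum ?\<mu> V = sum u ?C"
    using CV finite_vertices by (intro sum.mono_neutral_cong_right) auto
  moreover have "(\<Sum>v\<in>V. ?\<mu> v *\<^sub>R v) = (\<Sum>v\<in>?C. u v *\<^sub>R v)"
    using CV finite_vertices by (intro sum.mono_neutral_cong_right) auto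
  ultimately have "barycentric \<T> x ?\<mu>"
    unfolding barycentric_def using u S by auto
  then show ?thesis by blast
qed

lemma barycentric_weight: "x \<in> D \<Longrightarrow> barycentric \<T> x (weight \<T> x)"
  unfolding weight_def using barycentric_exists by (rule someI_ex)

text \<open>Two simplices of a triangulation meet in a common face. It contains \<open>x\<close>,
  hence the whole support of \<open>\<mu>\<close>, and an extreme point of one simplex that lies in
  the face is extreme in the face and so in the other simplex. Thus it does not matter which simplex
  the choice in \<open>weight\<close> selected.\<close>

lemma barycentric_in_every_simplex:
  assumes "barycentric \<T> x \<mu>" "S \<in> \<T>" "x \<in> S" "\<mu> v \<noteq> 0"
  shows "v extreme_point_of S"
proof -
  from assms(1) obtain S' where S': "S' \<in> \<T>" "x \<in> S'" "\<And>v. \<mu> v \<noteq> 0 \<Longrightarrow> v extreme_point_of S'"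
    and \<mu>: "\<And>v. 0 \<le> \<mu> v" "sum \<mu> V = 1" "(\<Sum>v\<in>V. \<mu> v *\<^sub>R v) = x"
    unfolding barycentric_def by auto
  have F: "(S \<inter> S') face_of S" "(S \<inter> S') face_of S'"
    using triangulation assms(2) S'(1) unfolding triangulation_def by (blast, metis Int_commute)
  have cvx: "convex S'" using S'(1) by (meson simplexE convex_simplex)
  have vV: "v \<in> V" using S'(1,3) assms(4) unfolding vertices_def by blast
  have sub: "u \<in> S'" if "\<mu> u \<noteq> 0" for u
    using S'(3)[OF that] by (simp add: extreme_point_of_def)
  have xF: "(\<Sum>v\<in>V. \<mu> v *\<^sub>R v) \<in> S \<inter> S'"
    unfolding \<mu>(3) using assms(3) S'(2) by blast
  have "v \<in> S \<inter> S'"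
    by (rule face_contains_support[OF F(2) finite_vertices sub \<mu>(1,2) xF vV assms(4) cvx])
  then have "v extreme_point_of (S \<inter> S')"
    using extreme_point_of_face[OF F(2)] S'(3) assms(4) by auto
  then show ?thesis using extreme_point_of_face[OF F(1)] by auto
qed

section \<open>Finite element functions as weighted means of vertex values\<close>

lemma fe_space_eq_sum:
  assumes "w \<in> fe_space \<T> h" "x \<in> D" "a \<in> grid h"
  shows "w (x, a) = (\<Sum>v\<in>V. weight \<T> x v * w (v, a))"
proof -
  have b: "barycentric \<T> x (weight \<T> x)" using assms by (intro barycentric_weight)
  then obtain S where S: "S \<in> \<T>" "x \<in> S" "\<And>v. weight \<T> x v \<noteq> 0 \<Longrightarrow> v extreme_point_of S"
    unfolding barycentric_def by auto
  obtain p q where pq: "\<And>y. y \<in> S \<Longrightarrow> w (y, a) = p \<bullet> y + q"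
    using assms(1,3) S(1) unfolding fe_space_def by blast
  have "(\<Sum>v\<in>V. weight \<T> x v * w (v, a)) = (\<Sum>v\<in>V. weight \<T> x v * (p \<bullet> v + q))"
  proof (rule sum.cong)
    fix v
    show "weight \<T> x v * w (v, a) = weight \<T> x v * (p \<bullet> v + q)"
      using S(3)[of v] pq[of v] by (cases "weight \<T> x v = 0") (auto simp: extreme_point_of_def)
  qed simp
  also have "\<dots> = p \<bullet> x + q"
    using b unfolding barycentric_def by (subst sum_affine_combination) auto
  finally show ?thesis using pq S by simp
qed

lemma fe_space_eqI:
  assumes "w \<in> fe_space \<T> h" "w' \<in> fe_space \<T> h"
    and "\<And>v a. v \<in> V \<Longrightarrow> a \<in> grid h \<Longrightarrow> w (v, a) = w' (v, a)"
  shows "w = w'"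
proof (rule extensionalityI)
  show "w \<in> extensional (D \<times> grid h)" "w' \<in> extensional (D \<times> grid h)"
    using assms by (auto simp: fe_space_def)
  fix z assume "z \<in> D \<times> grid h"
  then obtain x a where z: "z = (x, a)" "x \<in> D" "a \<in> grid h" by auto
  show "w z = w' z"
    unfolding z(1) fe_space_eq_sum[OF assms(1) z(2,3)] fe_space_eq_sum[OF assms(2) z(2,3)]
    using assms(3) z(3) by (intro sum.cong) auto
qed

text \<open>The candidate averages the vertex values with \<open>weight\<close>. On each simplex it
  coincides with the affine interpolant of that simplex, wherever the weights came from, so
  continuity follows by gluing finitely many closed pieces.\<close>

lemma fe_space_interpolate:
  obtains w where "w \<in> fe_space \<T> h" "\<And>v a. v \<in> V \<Longrightarrow> a \<in> grid h \<Longrightarrow> w (v, a) = \<phi> (v, a)"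
proof -
  define w where "w = restrict (\<lambda>(x, a). \<Sum>v\<in>V. weight \<T> x v * \<phi> (v, a)) (D \<times> grid h)"
  have aff: "\<exists>p q. (\<forall>x\<in>S. w (x, a) = p \<bullet> x + q) \<and> (\<forall>v. v extreme_point_of S \<longrightarrow> \<phi> (v, a) = p \<bullet> v + q)"
    if a: "a \<in> grid h" and S: "S \<in> \<T>" for a S
  proof -
    obtain n where "n simplex S" using simplexE S by blast
    from affine_interpolation[OF simplex_extreme_points(1)[OF this], of "\<lambda>v. \<phi> (v, a)"]
    obtain p q where pq: "\<And>v. v extreme_point_of S \<Longrightarrow> p \<bullet> v + q = \<phi> (v, a)" by auto
    have "w (x, a) = p \<bullet> x + q" if x: "x \<in> S" for x
    proof -
      have xD: "x \<in> D" using x S by auto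
      note b = barycentric_weight[OF xD]
      have "w (x, a) = (\<Sum>v\<in>V. weight \<T> x v * \<phi> (v, a))"
        unfolding w_def using xD a by simp
      also have "\<dots> = (\<Sum>v\<in>V. weight \<T> x v * (p \<bullet> v + q))"
        using barycentric_in_every_simplex[OF b S x] pq
        by (intro sum.cong) (metis mult_eq_0_iff)+
      also have "\<dots> = p \<bullet> x + q"
        using b unfolding barycentric_def by (subst sum_affine_combination) auto
      finally show ?thesis .
    qed
    then show ?thesis using pq by metis
  qed
  show thesis
  proof (rule that[of w])
    show "w \<in> fe_space \<T> h"
      unfolding fe_space_def
    proof (intro CollectI conjI ballI)
      show "w \<in> extensional (D \<times> grid h)" unfolding w_def by simp
      fix a assume a: "a \<in> grid h"
      show "continuous_on D (\<lambda>x. w (x, a))"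
      proof -
        have "continuous_on (\<Union>S\<in>\<T>. S) (\<lambda>x. w (x, a))"
        proof (rule continuous_on_closed_Union)
          show "finite \<T>" using triangulation unfolding triangulation_def by auto
          fix S assume S: "S \<in> \<T>"
          show "closed S" using S by (meson simplexE closed_simplex)
          obtain p q where "\<forall>x\<in>S. w (x, a) = p \<bullet> x + q" using aff[OF a S] by auto
          then show "continuous_on S (\<lambda>x. w (x, a))"
            by (subst continuous_on_cong[where g="\<lambda>x. p \<bullet> x + q"]) (auto intro!: continuous_intros)
        qed
        then show ?thesis by simp
      qed
      fix S assume "S \<in> \<T>"
      then show "\<exists>p q. \<forall>x\<in>S. w (x, a) = p \<bullet> x + q" using aff a by blast
    qed
    fix v a assume v: "v \<in> V" and a: "a \<in> grid h"
    obtain S where S: "S \<in> \<T>" "v extreme_point_of S" using v by (auto simp: vertices_def)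
    then have "v \<in> S" by (auto simp: extreme_point_of_def)
    then show "w (v, a) = \<phi> (v, a)" using aff[OF a S(1)] S(2) by auto
  qed
qed

section \<open>Mean and variance of the barycentric weights\<close>

lemma weight_nonneg: "x \<in> D \<Longrightarrow> 0 \<le> weight \<T> x v"
  and weight_sum: "x \<in> D \<Longrightarrow> sum (weight \<T> x) V = 1"
  and weight_mean: "x \<in> D \<Longrightarrow> (\<Sum>v\<in>V. weight \<T> x v *\<^sub>R v) = x"
  using barycentric_weight unfolding barycentric_def by auto

lemma weight_support:
  assumes "x \<in> D" "weight \<T> x v \<noteq> 0" shows "norm (v - x) \<le> k"
proof -
  obtain S where S: "S \<in> \<T>" "x \<in> S" "v extreme_point_of S"
    using barycentric_weight[OF assms(1)] assms(2) unfolding barycentric_def by auto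
  have "bounded S" using S(1) by (meson simplexE compact_simplex compact_imp_bounded)
  then have "dist v x \<le> diameter S"
    using S by (intro diameter_bounded_bound) (auto simp: extreme_point_of_def)
  then show ?thesis using diameter_le[OF S(1)] by (simp add: dist_norm)
qed

text \<open>The barycentric weights are centred at \<open>x\<close>, so only the variance enters.\<close>

lemma weight_square:
  assumes "x \<in> D"
  shows "(\<Sum>v\<in>V. weight \<T> x v * (norm (v - y))\<^sup>2) \<le> (norm (x - y))\<^sup>2 + k\<^sup>2"
proof -
  let ?\<mu> = "weight \<T> x"
  \<comment> \<open>Everything beyond the first square is affine in \<open>v\<close>, so its
    weighted mean is its value at \<open>x\<close>, namely
    \<open>(norm (x - y))\<^sup>2\<close>.\<close>
  have e: "(norm (v - y))\<^sup>2 = (norm (v - x))\<^sup>2 + (2 * ((x - y) \<bullet> v) + (- 2 * ((x - y) \<bullet> x) + (norm (x - y))\<^sup>2))" for v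
    unfolding power2_norm_eq_inner by (simp add: inner_simps inner_commute)
  have "(\<Sum>v\<in>V. ?\<mu> v * (norm (v - y))\<^sup>2)
     = (\<Sum>v\<in>V. ?\<mu> v * (norm (v - x))\<^sup>2) + (\<Sum>v\<in>V. ?\<mu> v * ((2 *\<^sub>R (x - y)) \<bullet> v + (- 2 * ((x - y) \<bullet> x) + (norm (x - y))\<^sup>2)))"
    unfolding sum.distrib[symmetric]
    by (rule sum.cong[OF refl]) (subst e, simp only: inner_scaleR_left distrib_left)
  also have "(\<Sum>v\<in>V. ?\<mu> v * ((2 *\<^sub>R (x - y)) \<bullet> v + (- 2 * ((x - y) \<bullet> x) + (norm (x - y))\<^sup>2))) = (norm (x - y))\<^sup>2"
    by (subst sum_affine_combination) (simp_all add: weight_sum[OF assms] weight_mean[OF assms])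
  also have "(\<Sum>v\<in>V. ?\<mu> v * (norm (v - x))\<^sup>2) \<le> (\<Sum>v\<in>V. ?\<mu> v * k\<^sup>2)"
  proof (rule sum_mono)
    fix v
    show "?\<mu> v * (norm (v - x))\<^sup>2 \<le> ?\<mu> v * k\<^sup>2"
      using weight_support[OF assms, of v] weight_nonneg[OF assms, of v]
      by (cases "?\<mu> v = 0") (auto intro!: mult_left_mono power_mono)
  qed
  also have "\<dots> = k\<^sup>2" by (simp add: sum_distrib_right[symmetric] weight_sum[OF assms])
  finally show ?thesis by simp
qed

text \<open>Jensen's inequality for the square root, obtained by majorizing the root by its tangent
  at \<open>M\<^sup>2\<close>, where \<open>M\<close> is the claimed bound; \<open>c > 0\<close>
  keeps \<open>M\<close> positive.\<close>

lemma weight_sqrt: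
  assumes "x \<in> D" "c > 0"
  shows "(\<Sum>v\<in>V. weight \<T> x v * sqrt ((norm (v - y))\<^sup>2 + c)) \<le> sqrt ((norm (x - y))\<^sup>2 + k\<^sup>2 + c)"
proof -
  let ?\<mu> = "weight \<T> x"
  define M where "M = sqrt ((norm (x - y))\<^sup>2 + k\<^sup>2 + c)"
  have M: "M > 0" "M\<^sup>2 = (norm (x - y))\<^sup>2 + k\<^sup>2 + c"
    using assms(2) by (auto simp: M_def add_nonneg_pos)
  have amgm: "sqrt t \<le> (t + M\<^sup>2) / (2 * M)" if "t \<ge> 0" for t
  proof -
    have "2 * M * sqrt t \<le> M\<^sup>2 + (sqrt t)\<^sup>2"
      using sum_squares_bound[of M "sqrt t"] by simp
    then show ?thesis using M that by (simp add: field_simps)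
  qed
  have "(\<Sum>v\<in>V. ?\<mu> v * sqrt ((norm (v - y))\<^sup>2 + c)) \<le> (\<Sum>v\<in>V. ?\<mu> v * (((norm (v - y))\<^sup>2 + c + M\<^sup>2) / (2 * M)))"
    using assms weight_nonneg[OF assms(1)] by (intro sum_mono mult_left_mono amgm) auto
  also have "\<dots> = ((\<Sum>v\<in>V. ?\<mu> v * (norm (v - y))\<^sup>2) + sum ?\<mu> V * (c + M\<^sup>2)) / (2 * M)"
    by (simp add: sum_distrib_right sum.distrib[symmetric] sum_divide_distrib distrib_left add.assoc)
  also have "\<dots> \<le> (2 * M\<^sup>2) / (2 * M)"
    using weight_square[OF assms(1), of y] M by (intro divide_right_mono) (auto simp: weight_sum[OF assms(1)])
  also have "\<dots> = M" using M(1) by (simp add: power2_eq_square)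
  finally show ?thesis unfolding M_def .
qed

end

section \<open>The discrete solution and the Euler scheme\<close>

text \<open>The maximum \<open>B\<close> over \<open>Z\<close> satisfies
  \<open>B \<le> q * B + c\<close>. With c = 0 this gives uniqueness of the discrete solution, with
  \<open>c = h * M\<^sub>f\<close> its a priori bound.\<close>

lemma abs_le_of_sup_recursion:
  fixes v :: "'z \<Rightarrow> real"
  assumes "finite Z" "q < 1"
    and rec: "\<And>B z. (\<And>y. y \<in> Z \<Longrightarrow> \<bar>v y\<bar> \<le> B) \<Longrightarrow> z \<in> Z \<Longrightarrow> \<bar>v z\<bar> \<le> q * B + c"
    and "z \<in> Z"
  shows "\<bar>v z\<bar> \<le> c / (1 - q)"
proof -
  define B where "B = Max ((\<lambda>z. \<bar>v z\<bar>) ` Z)"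
  have le: "\<bar>v y\<bar> \<le> B" if "y \<in> Z" for y
    unfolding B_def using assms(1) that by simp
  have "B \<in> (\<lambda>z. \<bar>v z\<bar>) ` Z"
    unfolding B_def using assms by (intro Max_in) auto
  then have "B \<le> q * B + c" using rec[OF le] by auto
  then have "B * (1 - q) \<le> c" by (simp add: algebra_simps)
  then have "B \<le> c / (1 - q)" using assms(2) by (simp add: pos_le_divide_eq)
  then show ?thesis using le[OF assms(4)] by simp
qed

text \<open>Banach iteration in the maximum norm. The functions live on the whole type but are
  compared only on the finite set \<open>Z\<close>, so the fixed point equation is obtained on
  \<open>Z\<close> alone.\<close>

lemma finite_sup_contraction_fixpoint:
  fixes F :: "('z \<Rightarrow> real) \<Rightarrow> 'z \<Rightarrow> real"
  assumes "finite Z" "0 \<le> q" "q < 1"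
    and contr: "\<And>v w B z. (\<And>y. y \<in> Z \<Longrightarrow> \<bar>v y - w y\<bar> \<le> B) \<Longrightarrow> z \<in> Z \<Longrightarrow> \<bar>F v z - F w z\<bar> \<le> q * B"
  shows "\<exists>v. \<forall>z\<in>Z. F v z = v z"
proof -
  define u where "u n = (F ^^ n) (\<lambda>_. 0)" for n
  have uS: "u (Suc n) = F (u n)" for n by (simp add: u_def)
  define B where "B = (\<Sum>z\<in>Z. \<bar>u 1 z - u 0 z\<bar>)"
  have step: "\<bar>u (Suc n) z - u n z\<bar> \<le> q ^ n * B" if "z \<in> Z" for n z
    using that
  proof (induction n arbitrary: z)
    case 0
    then show ?case unfolding B_def using assms(1) by (auto intro: member_le_sum)
  next
    case (Suc n)
    then have "\<bar>F (u (Suc n)) z - F (u n) z\<bar> \<le> q * (q ^ n * B)" by (intro contr) auto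
    then show ?case by (simp add: uS mult.assoc)
  qed
  have conv: "(\<lambda>n. u n z) \<longlonglongrightarrow> lim (\<lambda>n. u n z)" if "z \<in> Z" for z
  proof -
    have "summable (\<lambda>n. u (Suc n) z - u n z)"
    proof (rule summable_comparison_test)
      show "\<exists>N. \<forall>n\<ge>N. norm (u (Suc n) z - u n z) \<le> q ^ n * B" using step[OF that] by auto
      show "summable (\<lambda>n. q ^ n * B)" using assms by (intro summable_mult2 summable_geometric) auto
    qed
    then have "convergent (\<lambda>n. \<Sum>i<n. u (Suc i) z - u i z)"
      by (simp add: summable_iff_convergent)
    moreover have "(\<Sum>i<n. u (Suc i) z - u i z) = u n z - u 0 z" for n
      by (rule sum_lessThan_telescope)
    ultimately have "convergent (\<lambda>n. u n z - u 0 z)" by simp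
    then have "convergent (\<lambda>n. (u n z - u 0 z) + u 0 z)" by (intro convergent_add convergent_const)
    then show ?thesis by (simp add: convergent_LIMSEQ_iff)
  qed
  define v where "v z = lim (\<lambda>n. u n z)" for z
  have "F v z = v z" if z: "z \<in> Z" for z
  proof -
    have "(\<lambda>n. F (u n) z) \<longlonglongrightarrow> F v z"
    proof (rule LIMSEQ_I)
      fix e :: real assume e: "e > 0"
      have "\<forall>\<^sub>F n in sequentially. \<forall>y\<in>Z. \<bar>u n y - v y\<bar> < e"
      proof (rule eventually_ball_finite[OF assms(1)], rule ballI)
        fix y assume "y \<in> Z"
        from tendstoD[OF conv[OF this] e] show "\<forall>\<^sub>F n in sequentially. \<bar>u n y - v y\<bar> < e"
          by (simp add: v_def dist_real_def)
      qed
      then obtain N where N: "\<And>n y. n \<ge> N \<Longrightarrow> y \<in> Z \<Longrightarrow> \<bar>u n y - v y\<bar> < e"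
        unfolding eventually_sequentially by blast
      have "norm (F (u n) z - F v z) < e" if "n \<ge> N" for n
      proof -
        have "\<bar>F (u n) z - F v z\<bar> \<le> q * e"
          using N[OF that] z by (intro contr) (auto intro: less_imp_le)
        also have "\<dots> < e" using assms e by simp
        finally show ?thesis by simp
      qed
      then show "\<exists>no. \<forall>n\<ge>no. norm (F (u n) z - F v z) < e" by blast
    qed
    moreover have "(\<lambda>n. F (u n) z) \<longlonglongrightarrow> v z"
      using LIMSEQ_Suc[OF conv[OF z]] by (simp add: uS v_def)
    ultimately show ?thesis using LIMSEQ_unique by blast
  qed
  then show ?thesis by blast
qed

text \<open>A minimizer of one function is a competitor for the other. Comparing two minima is
  thereby reduced to one common control \<open>b\<close>.\<close>

lemma abs_Min_diff_le:
  fixes F G :: "'b \<Rightarrow> real"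
  assumes "finite B" "B \<noteq> {}" "\<And>b. b \<in> B \<Longrightarrow> \<bar>F b - G b\<bar> \<le> e"
  shows "\<bar>(MIN b\<in>B. F b) - (MIN b\<in>B. G b)\<bar> \<le> e"
proof -
  have *: "(MIN b\<in>B. F b) \<le> (MIN b\<in>B. G b) + e"
    if "\<And>b. b \<in> B \<Longrightarrow> \<bar>F b - G b\<bar> \<le> e" for F G :: "'b \<Rightarrow> real"
  proof -
    have "(MIN b\<in>B. G b) \<in> G ` B" using assms by (intro Min_in) auto
    then obtain b where b: "b \<in> B" "(MIN b\<in>B. G b) = G b" by auto
    have "(MIN b\<in>B. F b) \<le> F b" using assms b by (intro Min_le) auto
    then show ?thesis using that[OF b(1)] b(2) by linarith
  qed
  show ?thesis using *[of F G] *[of G F] assms(3) by (force simp: abs_minus_commute)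
qed

lemma finite_grid: "finite (grid h)"
proof -
  have "{i::nat. real i \<le> 1 / h} \<subseteq> {..nat \<lfloor>1 / h\<rfloor>}" by (auto simp: le_nat_floor)
  then have "finite {i::nat. real i \<le> 1 / h}" by (rule finite_subset) simp
  then show ?thesis unfolding grid_def
    by (simp add: setcompr_eq_image)
qed

lemma grid_subset: "h > 0 \<Longrightarrow> grid h \<subseteq> {0..1}"
  unfolding grid_def by (auto simp: field_simps)

lemma finite_grid_from: "finite (grid_from h a)"
  unfolding grid_from_def using finite_grid by blast

lemma grid_from_nonempty: "h > 0 \<Longrightarrow> a \<in> grid h \<Longrightarrow> grid_from h a \<noteq> {}"
  unfolding grid_from_def using grid_subset[of h] by fastforce

lemma grid_from_subset: "b \<in> grid_from h a \<Longrightarrow> b \<in> grid h"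
  unfolding grid_from_def by auto

lemma bounded_lipschitzD:
  assumes "bounded_lipschitz \<Omega> L B F" "x \<in> \<Omega>" "a \<in> {0..1}"
  shows "norm (F x a) \<le> B"
    and "x' \<in> \<Omega> \<Longrightarrow> a' \<in> {0..1} \<Longrightarrow> norm (F x a - F x' a') \<le> L * (norm (x - x') + \<bar>a - a'\<bar>)"
  using assms unfolding bounded_lipschitz_def by auto

text \<open>The deterministic counterpart of the scheme: the same dynamic programming step without
  interpolation, stopped after \<open>m\<close> steps with terminal value 0. The control
  \<open>a\<close> acts in the current step, and the minimum selects the control of the next
  one.\<close>

primrec horizon_value ::
  "('a::real_vector \<Rightarrow> real \<Rightarrow> 'a) \<Rightarrow> ('a \<Rightarrow> real \<Rightarrow> real) \<Rightarrow> real \<Rightarrow> real \<Rightarrow> nat \<Rightarrow> 'a \<Rightarrow> real \<Rightarrow> real" where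
  "horizon_value g f lam h 0 x a = 0"
| "horizon_value g f lam h (Suc m) x a =
     (MIN b\<in>grid_from h a. (1 - lam * h) * horizon_value g f lam h m (x + h *\<^sub>R g x a) b + h * f x a)"

text \<open>One mesh and one time step are fixed. \<open>L\<^sub>g\<close> is any Lipschitz bound,
  not the best one, so the locale can also be instantiated with an enlarged constant.\<close>

locale scheme = mesh \<T> k
  for \<T> :: "(real^'n) set set" and k :: real +
  fixes \<Omega> :: "(real^'n) set" and g :: "real^'n \<Rightarrow> real \<Rightarrow> real^'n" and f :: "real^'n \<Rightarrow> real \<Rightarrow> real"
    and lam h L\<^sub>g M\<^sub>g L\<^sub>f M\<^sub>f :: real
  assumes lam_pos: "lam > 0" and L\<^sub>g_pos: "L\<^sub>g > 0" and M\<^sub>g_pos: "M\<^sub>g > 0"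
    and L\<^sub>f_pos: "L\<^sub>f > 0" and M\<^sub>f_pos: "M\<^sub>f > 0"
    and k_pos: "k > 0" and h_pos: "h > 0" and lam_h: "lam * h < 1"
    and g_lip: "bounded_lipschitz \<Omega> L\<^sub>g M\<^sub>g g" and f_lip: "bounded_lipschitz \<Omega> L\<^sub>f M\<^sub>f f"
    and D_subset: "\<Union>\<T> \<subseteq> \<Omega>"
    and step_in: "x \<in> \<Union>\<T> \<Longrightarrow> a \<in> grid h \<Longrightarrow> x + h *\<^sub>R g x a \<in> \<Union>\<T>"
begin

section \<open>Well-posedness of the discrete equation\<close>

definition "q = 1 - lam * h"
definition "\<rho> = 1 + L\<^sub>g * h"

lemma q_bounds: "0 < q" "q < 1"
  unfolding q_def using lam_h lam_pos h_pos by auto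

lemma rho_gt_1: "\<rho> > 1"
  unfolding \<rho>_def using L\<^sub>g_pos h_pos by auto

lemma grid_01: "a \<in> grid h \<Longrightarrow> a \<in> {0..1}"
  using grid_subset[OF h_pos] by auto

lemma sum_weight_abs_le:
  assumes "x \<in> D" "\<And>v. v \<in> V \<Longrightarrow> \<bar>\<phi> v\<bar> \<le> B"
  shows "\<bar>\<Sum>v\<in>V. weight \<T> x v * \<phi> v\<bar> \<le> B"
proof -
  have "\<bar>\<Sum>v\<in>V. weight \<T> x v * \<phi> v\<bar> \<le> (\<Sum>v\<in>V. weight \<T> x v * B)"
    using assms(2) weight_nonneg[OF assms(1)]
    by (intro order_trans[OF sum_abs] sum_mono) (simp add: abs_mult mult_left_mono)
  then show ?thesis by (simp add: sum_distrib_right[symmetric] weight_sum[OF assms(1)])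
qed

text \<open>\<open>fe_space_interpolate\<close> gives existence and \<open>fe_space_eqI\<close>
  uniqueness of the described function, so the definite description in \<open>scheme_op\<close>
  denotes it for every \<open>w\<close>.\<close>

lemma scheme_op_spec:
  "scheme_op g f lam \<T> h w \<in> fe_space \<T> h \<and>
    (\<forall>x\<in>V. \<forall>a\<in>grid h. scheme_op g f lam \<T> h w (x, a) =
       (MIN b\<in>grid_from h a. (1 - lam * h) * w (x + h *\<^sub>R g x a, b) + h * f x a))"
proof -
  obtain w' where "w' \<in> fe_space \<T> h" "\<And>v a. v \<in> V \<Longrightarrow> a \<in> grid h \<Longrightarrow> w' (v, a) =
      (\<lambda>(x, a). MIN b\<in>grid_from h a. (1 - lam * h) * w (x + h *\<^sub>R g x a, b) + h * f x a) (v, a)"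
    using fe_space_interpolate by blast
  then have "\<exists>!w'. w' \<in> fe_space \<T> h \<and> (\<forall>x\<in>V. \<forall>a\<in>grid h. w' (x, a) =
       (MIN b\<in>grid_from h a. (1 - lam * h) * w (x + h *\<^sub>R g x a, b) + h * f x a))"
    by (intro ex1I[of _ w'] conjI) (auto intro: fe_space_eqI)
  from theI'[OF this] show ?thesis unfolding scheme_op_def .
qed

lemma scheme_op_fixed_iff:
  assumes "w \<in> fe_space \<T> h"
  shows "scheme_op g f lam \<T> h w = w \<longleftrightarrow>
    (\<forall>x\<in>V. \<forall>a\<in>grid h. w (x, a) =
       (MIN b\<in>grid_from h a. q * w (x + h *\<^sub>R g x a, b) + h * f x a))" (is "_ \<longleftrightarrow> ?R")
proof
  assume "scheme_op g f lam \<T> h w = w"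
  then show ?R unfolding q_def using scheme_op_spec[of w] by auto
next
  assume ?R
  then show "scheme_op g f lam \<T> h w = w"
    using scheme_op_spec[of w] assms unfolding q_def by (intro fe_space_eqI) auto
qed

text \<open>The weights are nonnegative with sum 1, so averaging does not increase the maximum norm,
  the running costs cancel, and only the discount \<open>q\<close> remains.\<close>

lemma step_contraction:
  assumes "\<And>y b. y \<in> V \<Longrightarrow> b \<in> grid h \<Longrightarrow> \<bar>\<phi> (y, b) - \<psi> (y, b)\<bar> \<le> B" "x \<in> V" "a \<in> grid h"
  shows "\<bar>(MIN b\<in>grid_from h a. q * (\<Sum>v\<in>V. weight \<T> (x + h *\<^sub>R g x a) v * \<phi> (v, b)) + h * f x a)
     - (MIN b\<in>grid_from h a. q * (\<Sum>v\<in>V. weight \<T> (x + h *\<^sub>R g x a) v * \<psi> (v, b)) + h * f x a)\<bar> \<le> q * B"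
proof (rule abs_Min_diff_le[OF finite_grid_from grid_from_nonempty[OF h_pos assms(3)]])
  fix b assume b: "b \<in> grid_from h a"
  let ?z = "x + h *\<^sub>R g x a"
  have z: "?z \<in> D" using assms vertices_subset by (intro step_in) auto
  have "\<bar>\<Sum>v\<in>V. weight \<T> ?z v * (\<phi> (v, b) - \<psi> (v, b))\<bar> \<le> B"
    using assms(1) grid_from_subset[OF b] by (intro sum_weight_abs_le[OF z]) auto
  then have "\<bar>q * (\<Sum>v\<in>V. weight \<T> ?z v * (\<phi> (v, b) - \<psi> (v, b)))\<bar> \<le> q * B"
    using q_bounds by (simp add: abs_mult mult_left_mono)
  then show "\<bar>q * (\<Sum>v\<in>V. weight \<T> ?z v * \<phi> (v, b)) + h * f x a
     - (q * (\<Sum>v\<in>V. weight \<T> ?z v * \<psi> (v, b)) + h * f x a)\<bar> \<le> q * B"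
    by (simp add: right_diff_distrib sum_subtractf)
qed

lemma fe_Min_eq:
  assumes "w \<in> fe_space \<T> h" "x \<in> D" "a \<in> grid h"
  shows "(MIN b\<in>grid_from h a. q * w (x + h *\<^sub>R g x a, b) + h * f x a)
     = (MIN b\<in>grid_from h a. q * (\<Sum>v\<in>V. weight \<T> (x + h *\<^sub>R g x a) v * w (v, b)) + h * f x a)"
proof -
  have z: "x + h *\<^sub>R g x a \<in> D" using assms by (intro step_in) auto
  have "(\<lambda>b. q * w (x + h *\<^sub>R g x a, b) + h * f x a) ` grid_from h a
      = (\<lambda>b. q * (\<Sum>v\<in>V. weight \<T> (x + h *\<^sub>R g x a) v * w (v, b)) + h * f x a) ` grid_from h a"
    using fe_space_eq_sum[OF assms(1) z grid_from_subset] by (intro image_cong) auto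
  then show ?thesis by simp
qed

text \<open>The equation is first solved on the finite set \<open>V \<times> grid h\<close>, where
  interpolation has turned into a mean of vertex values; the solution is then extended by
  interpolation.\<close>

lemma discrete_solution_ex1:
  "\<exists>!w. w \<in> fe_space \<T> h \<and> scheme_op g f lam \<T> h w = w"
proof -
  define F where "F \<phi> z = (case z of (x, a) \<Rightarrow>
      MIN b\<in>grid_from h a. q * (\<Sum>v\<in>V. weight \<T> (x + h *\<^sub>R g x a) v * \<phi> (v, b)) + h * f x a)" for \<phi> z
  have fin: "finite (V \<times> grid h)" using finite_vertices finite_grid by blast
  have contr: "\<bar>F \<phi> z - F \<psi> z\<bar> \<le> q * B"
    if le: "\<And>y. y \<in> V \<times> grid h \<Longrightarrow> \<bar>\<phi> y - \<psi> y\<bar> \<le> B" and zZ: "z \<in> V \<times> grid h" for \<phi> \<psi> B z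
  proof -
    obtain x a where z: "z = (x, a)" "x \<in> V" "a \<in> grid h" using zZ by auto
    show ?thesis unfolding F_def z(1) prod.case
      using le z(2,3) by (intro step_contraction) auto
  qed
  have fixed_iff: "scheme_op g f lam \<T> h w = w \<longleftrightarrow> (\<forall>z\<in>V \<times> grid h. w z = F w z)"
    if "w \<in> fe_space \<T> h" for w
  proof -
    have "F w (x, a) = (MIN b\<in>grid_from h a. q * w (x + h *\<^sub>R g x a, b) + h * f x a)"
      if "x \<in> V" "a \<in> grid h" for x a
      unfolding F_def prod.case
      by (rule fe_Min_eq[OF \<open>w \<in> fe_space \<T> h\<close> subsetD[OF vertices_subset that(1)] that(2), symmetric])
    then show ?thesis unfolding scheme_op_fixed_iff[OF \<open>w \<in> fe_space \<T> h\<close>] by auto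
  qed
  have "\<exists>\<phi>. \<forall>z\<in>V \<times> grid h. F \<phi> z = \<phi> z"
    by (rule finite_sup_contraction_fixpoint[OF fin less_imp_le[OF q_bounds(1)] q_bounds(2)], rule contr)
  then obtain \<phi> where \<phi>: "\<And>z. z \<in> V \<times> grid h \<Longrightarrow> F \<phi> z = \<phi> z" by blast
  obtain w where w: "w \<in> fe_space \<T> h" "\<And>v a. v \<in> V \<Longrightarrow> a \<in> grid h \<Longrightarrow> w (v, a) = \<phi> (v, a)"
    using fe_space_interpolate by blast
  \<comment> \<open>Contraction with bound 0: \<open>F\<close> sees only vertex values, and there
    \<open>w\<close> and \<open>\<phi>\<close> agree.\<close>
  have "F w z = F \<phi> z" if "z \<in> V \<times> grid h" for z
    using contr[of w \<phi> 0 z] that w(2) by auto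
  then have "scheme_op g f lam \<T> h w = w"
    unfolding fixed_iff[OF w(1)] using w(2) \<phi> by auto
  moreover have "w' = w" if w': "w' \<in> fe_space \<T> h" "scheme_op g f lam \<T> h w' = w'" for w'
  proof (rule fe_space_eqI[OF w'(1) w(1)])
    fix v a assume va: "v \<in> V" "a \<in> grid h"
    have "\<bar>w' (v, a) - w (v, a)\<bar> \<le> 0 / (1 - q)"
    proof (rule abs_le_of_sup_recursion[where v="\<lambda>z. w' z - w z", OF fin q_bounds(2)])
      fix B z
      assume "\<And>y. y \<in> V \<times> grid h \<Longrightarrow> \<bar>w' y - w y\<bar> \<le> B" and z: "z \<in> V \<times> grid h"
      then have "\<bar>F w' z - F w z\<bar> \<le> q * B" by (rule contr)
      moreover have "F w' z = w' z" "F w z = w z"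
        using w'(2) z \<open>scheme_op g f lam \<T> h w = w\<close> unfolding fixed_iff[OF w'(1)] fixed_iff[OF w(1)] by auto
      ultimately show "\<bar>w' z - w z\<bar> \<le> q * B + 0" by simp
    qed (use va in auto)
    then show "w' (v, a) = w (v, a)" by simp
  qed
  ultimately show ?thesis using w(1) by blast
qed

abbreviation "W \<equiv> discrete_solution g f lam \<T> h"

lemma W_fe: "W \<in> fe_space \<T> h"
  and W_vertex: "x \<in> V \<Longrightarrow> a \<in> grid h \<Longrightarrow>
    W (x, a) = (MIN b\<in>grid_from h a. q * W (x + h *\<^sub>R g x a, b) + h * f x a)"
proof -
  have *: "W \<in> fe_space \<T> h \<and> scheme_op g f lam \<T> h W = W"
    unfolding discrete_solution_def by (rule theI'[OF discrete_solution_ex1])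
  then show "W \<in> fe_space \<T> h" ..
  then show "W (x, a) = (MIN b\<in>grid_from h a. q * W (x + h *\<^sub>R g x a, b) + h * f x a)"
    if "x \<in> V" "a \<in> grid h"
    using * that scheme_op_fixed_iff by blast
qed

lemma f_bound: "x \<in> D \<Longrightarrow> a \<in> grid h \<Longrightarrow> \<bar>f x a\<bar> \<le> M\<^sub>f"
  using bounded_lipschitzD(1)[OF f_lip, of x a] D_subset grid_01[of a] by auto

text \<open>Since \<open>1 - q = lam * h\<close>, the recursion bound becomes
  \<open>M\<^sub>f / lam\<close>. It starts the induction over the horizon, where the Euler value is
  0.\<close>

lemma W_bound:
  assumes "x \<in> V" "a \<in> grid h"
  shows "\<bar>W (x, a)\<bar> \<le> M\<^sub>f / lam"
proof -
  have "\<bar>W (x, a)\<bar> \<le> (h * M\<^sub>f) / (1 - q)"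
  proof (rule abs_le_of_sup_recursion[where Z="V \<times> grid h", OF _ q_bounds(2)])
    show "finite (V \<times> grid h)" using finite_vertices finite_grid by blast
    fix B z
    assume B: "\<And>y. y \<in> V \<times> grid h \<Longrightarrow> \<bar>W y\<bar> \<le> B" and "z \<in> V \<times> grid h"
    then obtain x a where z: "z = (x, a)" "x \<in> V" "a \<in> grid h" by auto
    let ?y = "x + h *\<^sub>R g x a"
    have xD: "x \<in> D" using z vertices_subset by auto
    have "W z \<in> (\<lambda>b. q * W (?y, b) + h * f x a) ` grid_from h a"
      unfolding z(1) W_vertex[OF z(2,3)]
      using finite_grid_from grid_from_nonempty[OF h_pos z(3)] by (intro Min_in) auto
    then obtain b where b: "b \<in> grid_from h a" "W z = q * W (?y, b) + h * f x a" by auto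
    have "\<bar>W (?y, b)\<bar> \<le> B"
      unfolding fe_space_eq_sum[OF W_fe step_in[OF xD z(3)] grid_from_subset[OF b(1)]]
      using B grid_from_subset[OF b(1)] by (intro sum_weight_abs_le step_in xD z) auto
    then have "\<bar>q * W (?y, b)\<bar> \<le> q * B"
      using q_bounds by (simp add: abs_mult mult_left_mono)
    moreover have "\<bar>h * f x a\<bar> \<le> h * M\<^sub>f"
      using f_bound[OF xD z(3)] h_pos by (simp add: abs_mult mult_left_mono)
    ultimately show "\<bar>W z\<bar> \<le> q * B + h * M\<^sub>f" unfolding b(2) by linarith
  qed (use assms in auto)
  then show ?thesis using h_pos lam_pos unfolding q_def by (simp add: field_simps)
qed

section \<open>Interpolated scheme versus Euler dynamic programming\<close>

lemma step_lip:
  assumes "x \<in> \<Omega>" "y \<in> \<Omega>" "a \<in> {0..1}"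
  shows "norm ((x + h *\<^sub>R g x a) - (y + h *\<^sub>R g y a)) \<le> \<rho> * norm (x - y)"
proof -
  have "norm ((x + h *\<^sub>R g x a) - (y + h *\<^sub>R g y a)) = norm ((x - y) + h *\<^sub>R (g x a - g y a))"
    by (simp add: algebra_simps)
  also have "\<dots> \<le> norm (x - y) + h * norm (g x a - g y a)"
    using h_pos by (intro order_trans[OF norm_triangle_ineq]) simp
  also have "\<dots> \<le> norm (x - y) + h * (L\<^sub>g * norm (x - y))"
    using bounded_lipschitzD(2)[OF g_lip assms(1,3) assms(2,3)] h_pos by simp
  finally show ?thesis unfolding \<rho>_def by (simp add: algebra_simps)
qed

text \<open>
  The weights turn the scheme into a controlled Markov chain whose noise has variance at most
  \<open>k\<^sup>2\<close> per step and is amplified by \<open>\<rho>\<^sup>2\<close>; \<open>noise\<close> is the total of these variances, discounted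
  by the amplification.
\<close>

definition "noise = k\<^sup>2 / (\<rho>\<^sup>2 - 1)"

lemma rho2: "\<rho>\<^sup>2 > 1"
  using rho_gt_1 by (simp add: power2_eq_square less_1_mult)

lemma noise_pos: "noise > 0"
  unfolding noise_def using k_pos rho2 by simp

lemma noise_step: "k\<^sup>2 + noise = \<rho>\<^sup>2 * noise"
  unfolding noise_def using rho2 by (simp add: field_simps)

text \<open>The averaging half of a step: the reference value \<open>u\<close> does not depend on
  the random vertex, so only the root is affected, and it gains \<open>k\<^sup>2\<close>.\<close>

lemma sum_weight_sqrt_le:
  assumes x: "x \<in> D" and "0 \<le> A"
    and le: "\<And>v. v \<in> V \<Longrightarrow> \<bar>\<phi> v - u\<bar> \<le> A * sqrt ((norm (v - y))\<^sup>2 + noise) + C"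
  shows "\<bar>(\<Sum>v\<in>V. weight \<T> x v * \<phi> v) - u\<bar> \<le> A * sqrt ((norm (x - y))\<^sup>2 + k\<^sup>2 + noise) + C"
proof -
  let ?s = "\<lambda>v. sqrt ((norm (v - y))\<^sup>2 + noise)"
  have "(\<Sum>v\<in>V. weight \<T> x v * \<phi> v) - u = (\<Sum>v\<in>V. weight \<T> x v * (\<phi> v - u))"
    by (simp add: right_diff_distrib sum_subtractf sum_distrib_right[symmetric] weight_sum[OF x])
  also have "\<bar>\<dots>\<bar> \<le> (\<Sum>v\<in>V. weight \<T> x v * (A * ?s v + C))"
    using le weight_nonneg[OF x]
    by (intro order_trans[OF sum_abs] sum_mono) (simp add: abs_mult mult_left_mono)
  also have "\<dots> = (\<Sum>v\<in>V. A * (weight \<T> x v * ?s v) + weight \<T> x v * C)"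
    by (simp add: distrib_left mult.left_commute)
  also have "\<dots> = A * (\<Sum>v\<in>V. weight \<T> x v * ?s v) + C"
    by (simp add: sum.distrib sum_distrib_left[symmetric] sum_distrib_right[symmetric] weight_sum[OF x])
  also have "\<dots> \<le> A * sqrt ((norm (x - y))\<^sup>2 + k\<^sup>2 + noise) + C"
    using weight_sqrt[OF x noise_pos] \<open>0 \<le> A\<close> by (intro add_mono mult_left_mono) auto
  finally show ?thesis .
qed

text \<open>Two starting points are needed for the induction: after one step the chain sits at a
  vertex, while the Euler path is at some other point of the mesh. A step contributes at most
  \<open>h * L\<^sub>f\<close> times the root to the cost; later roots are amplified by
  \<open>\<rho>\<close> and discounted by \<open>q\<close>, whence the geometric sum.\<close>

lemma W_horizon_vertex:
  assumes "x \<in> V" "y \<in> D" "a \<in> grid h"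
  shows "\<bar>W (x, a) - horizon_value g f lam h m y a\<bar>
    \<le> h * L\<^sub>f * (\<Sum>n<m. (q * \<rho>) ^ n) * sqrt ((norm (x - y))\<^sup>2 + noise) + q ^ m * (M\<^sub>f / lam)"
  using assms
proof (induction m arbitrary: x y a)
  case 0
  then show ?case using W_bound by simp
next
  case (Suc m)
  define G where "G = (\<Sum>n<m. (q * \<rho>) ^ n)"
  have G0: "0 \<le> G" unfolding G_def using q_bounds rho_gt_1 by (intro sum_nonneg) simp
  have GS: "(\<Sum>n<Suc m. (q * \<rho>) ^ n) = 1 + q * \<rho> * G"
    unfolding G_def sum.lessThan_Suc_shift by (simp add: sum_distrib_left)
  define R where "R = sqrt ((norm (x - y))\<^sup>2 + noise)"
  have xD: "x \<in> D" using Suc.prems vertices_subset by auto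
  have x\<Omega>: "x \<in> \<Omega>" and y\<Omega>: "y \<in> \<Omega>" using xD Suc.prems D_subset by auto
  have a: "a \<in> {0..1}" using Suc.prems grid_01 by auto
  let ?x = "x + h *\<^sub>R g x a" and ?y = "y + h *\<^sub>R g y a"
  have xD': "?x \<in> D" and yD': "?y \<in> D" using step_in xD Suc.prems by auto
  have f: "\<bar>f x a - f y a\<bar> \<le> L\<^sub>f * R"
  proof -
    have "\<bar>f x a - f y a\<bar> \<le> L\<^sub>f * norm (x - y)"
      using bounded_lipschitzD(2)[OF f_lip x\<Omega> a y\<Omega> a] by simp
    also have "norm (x - y) \<le> R" unfolding R_def using noise_pos by (intro real_le_rsqrt) simp
    finally show ?thesis using L\<^sub>f_pos by simp
  qed
  have "\<bar>(MIN b\<in>grid_from h a. q * W (?x, b) + h * f x a)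
     - (MIN b\<in>grid_from h a. q * horizon_value g f lam h m ?y b + h * f y a)\<bar>
     \<le> q * (h * L\<^sub>f * G * (\<rho> * R) + q ^ m * (M\<^sub>f / lam)) + h * (L\<^sub>f * R)"
  proof (rule abs_Min_diff_le[OF finite_grid_from grid_from_nonempty[OF h_pos Suc.prems(3)]])
    \<comment> \<open>Both minima are compared at the same next control, and the current control
      \<open>a\<close> agrees as well, so only the states differ.\<close>
    fix b assume "b \<in> grid_from h a"
    then have b: "b \<in> grid h" by (rule grid_from_subset)
    let ?U = "horizon_value g f lam h m ?y b"
    have "(norm (?x - ?y))\<^sup>2 \<le> (\<rho> * norm (x - y))\<^sup>2"
      using step_lip[OF x\<Omega> y\<Omega> a] by (intro power_mono) auto
    then have "(norm (?x - ?y))\<^sup>2 + k\<^sup>2 + noise \<le> \<rho>\<^sup>2 * ((norm (x - y))\<^sup>2 + noise)"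
      using noise_step by (simp add: power_mult_distrib distrib_left)
    then have "sqrt ((norm (?x - ?y))\<^sup>2 + k\<^sup>2 + noise) \<le> sqrt (\<rho>\<^sup>2 * ((norm (x - y))\<^sup>2 + noise))"
      by (rule real_sqrt_le_mono)
    also have "\<dots> = \<rho> * R"
      unfolding R_def real_sqrt_mult using rho_gt_1 by simp
    finally have R: "sqrt ((norm (?x - ?y))\<^sup>2 + k\<^sup>2 + noise) \<le> \<rho> * R" .
    have A: "0 \<le> h * L\<^sub>f * G" using G0 h_pos L\<^sub>f_pos by simp
    have "\<bar>W (?x, b) - ?U\<bar> \<le> h * L\<^sub>f * G * sqrt ((norm (?x - ?y))\<^sup>2 + k\<^sup>2 + noise) + q ^ m * (M\<^sub>f / lam)"
      unfolding fe_space_eq_sum[OF W_fe xD' b]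
      by (rule sum_weight_sqrt_le[OF xD' A]) (rule Suc.IH[OF _ yD' b, folded G_def])
    also have "\<dots> \<le> h * L\<^sub>f * G * (\<rho> * R) + q ^ m * (M\<^sub>f / lam)"
      using mult_left_mono[OF R A] by simp
    finally have "\<bar>q * (W (?x, b) - ?U)\<bar> \<le> q * (h * L\<^sub>f * G * (\<rho> * R) + q ^ m * (M\<^sub>f / lam))"
      using q_bounds by (simp add: abs_mult mult_left_mono)
    moreover have "\<bar>h * (f x a - f y a)\<bar> \<le> h * (L\<^sub>f * R)"
      using f h_pos by (simp add: abs_mult mult_left_mono)
    ultimately show "\<bar>(q * W (?x, b) + h * f x a) - (q * ?U + h * f y a)\<bar>
      \<le> q * (h * L\<^sub>f * G * (\<rho> * R) + q ^ m * (M\<^sub>f / lam)) + h * (L\<^sub>f * R)"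
      by (simp only: right_diff_distrib)
  qed
  then have "\<bar>W (x, a) - horizon_value g f lam h (Suc m) y a\<bar>
     \<le> q * (h * L\<^sub>f * G * (\<rho> * R) + q ^ m * (M\<^sub>f / lam)) + h * (L\<^sub>f * R)"
    using W_vertex[OF Suc.prems(1,3)] by (simp add: q_def)
  also have "\<dots> = h * L\<^sub>f * (1 + q * \<rho> * G) * R + q ^ Suc m * (M\<^sub>f / lam)"
    by (simp add: algebra_simps)
  finally show ?case unfolding GS R_def .
qed

text \<open>At a point that need not be a vertex, \<open>W\<close> is a mean of vertex values. With
  both starting points equal, the root after this first jump is
  \<open>sqrt (k\<^sup>2 + noise) = \<rho> * sqrt noise\<close>.\<close>

lemma W_horizon:
  assumes "x \<in> D" "a \<in> grid h"
  shows "\<bar>W (x, a) - horizon_value g f lam h m x a\<bar>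
    \<le> h * L\<^sub>f * (\<Sum>n<m. (q * \<rho>) ^ n) * (\<rho> * sqrt noise) + q ^ m * (M\<^sub>f / lam)"
proof -
  define G where "G = (\<Sum>n<m. (q * \<rho>) ^ n)"
  have G0: "0 \<le> G" unfolding G_def using q_bounds rho_gt_1 by (intro sum_nonneg) simp
  have A: "0 \<le> h * L\<^sub>f * G" using G0 h_pos L\<^sub>f_pos by simp
  have "sqrt ((norm (x - x))\<^sup>2 + k\<^sup>2 + noise) = \<rho> * sqrt noise"
    using noise_step rho_gt_1 by (simp add: real_sqrt_mult)
  moreover have "\<bar>W (x, a) - horizon_value g f lam h m x a\<bar>
    \<le> h * L\<^sub>f * G * sqrt ((norm (x - x))\<^sup>2 + k\<^sup>2 + noise) + q ^ m * (M\<^sub>f / lam)"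
    unfolding fe_space_eq_sum[OF W_fe assms]
    by (rule sum_weight_sqrt_le[OF assms(1) A]) (rule W_horizon_vertex[OF _ assms, where m=m, folded G_def])
  ultimately show ?thesis unfolding G_def by simp
qed

text \<open>Here the rate \<open>k / sqrt h\<close> appears:
  \<open>\<rho>\<^sup>2 - 1 \<ge> 2 * L\<^sub>g * h\<close> bounds \<open>noise\<close>, and
  \<open>h < 1 / lam\<close> bounds the leading factor \<open>\<rho>\<close>.\<close>

lemma rho_sqrt_noise_le: "\<rho> * sqrt noise \<le> (1 + L\<^sub>g / lam) / sqrt (2 * L\<^sub>g) * (k / sqrt h)"
proof -
  have "h < 1 / lam" using lam_h lam_pos by (simp add: field_simps)
  then have r: "\<rho> \<le> 1 + L\<^sub>g / lam"
    unfolding \<rho>_def using L\<^sub>g_pos mult_left_mono[of h "1 / lam" L\<^sub>g] by simp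
  have "\<rho>\<^sup>2 - 1 \<ge> 2 * L\<^sub>g * h" unfolding \<rho>_def by (simp add: power2_eq_square distrib_left distrib_right)
  then have "noise \<le> k\<^sup>2 / (2 * L\<^sub>g * h)"
    unfolding noise_def using L\<^sub>g_pos h_pos rho2 by (intro divide_left_mono mult_pos_pos) auto
  then have "sqrt noise \<le> sqrt (k\<^sup>2 / (2 * L\<^sub>g * h))" by (rule real_sqrt_le_mono)
  also have "\<dots> = 1 / sqrt (2 * L\<^sub>g) * (k / sqrt h)"
    using k_pos by (simp add: real_sqrt_divide real_sqrt_mult)
  finally have "\<rho> * sqrt noise \<le> (1 + L\<^sub>g / lam) * (1 / sqrt (2 * L\<^sub>g) * (k / sqrt h))"
    using r rho_gt_1 noise_pos by (intro mult_mono) auto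
  then show ?thesis by simp
qed

end

section \<open>Euler paths and trajectories\<close>

primrec euler :: "('a::real_vector \<Rightarrow> real \<Rightarrow> 'a) \<Rightarrow> real \<Rightarrow> (nat \<Rightarrow> real) \<Rightarrow> 'a \<Rightarrow> nat \<Rightarrow> 'a" where
  "euler g h a x 0 = x"
| "euler g h a x (Suc n) = euler g h a x n + h *\<^sub>R g (euler g h a x n) (a n)"

text \<open>\<open>euler\<close> recurses on the last step, whereas \<open>horizon_value\<close>
  unfolds from the first; this mediates between the two.\<close>

lemma euler_shift: "euler g h a x (Suc n) = euler g h (\<lambda>i. a (Suc i)) (x + h *\<^sub>R g x (a 0)) n"
  by (induction n) auto

lemma grid_from_iff: "h > 0 \<Longrightarrow> b \<in> grid_from h a \<longleftrightarrow> b \<in> grid h \<and> a \<le> b"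
  unfolding grid_from_def using grid_subset[of h] by auto

lemma euler_cost_Suc:
  "(\<Sum>n<Suc m. h * q ^ n * f (euler g h a x n) (a n))
   = q * (\<Sum>n<m. h * q ^ n * f (euler g h (\<lambda>i. a (Suc i)) (x + h *\<^sub>R g x (a 0)) n) (a (Suc n))) + h * f x (a 0)"
  unfolding sum.lessThan_Suc_shift euler_shift sum_distrib_left by (simp add: mult.assoc mult.left_commute)

text \<open>Together with \<open>horizon_value_attained\<close> this identifies
  \<open>horizon_value\<close> as the least Euler cost over nondecreasing grid sequences that start
  exactly at the given control.\<close>

lemma horizon_value_le:
  assumes "h > 0" "\<And>n. a n \<in> grid h" "\<And>n. a n \<le> a (Suc n)" "lam * h < 1"
  shows "horizon_value g f lam h m x (a 0) \<le> (\<Sum>n<m. h * (1 - lam * h) ^ n * f (euler g h a x n) (a n))"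
  using assms(2,3)
proof (induction m arbitrary: a x)
  case (Suc m)
  let ?x = "x + h *\<^sub>R g x (a 0)"
  have "horizon_value g f lam h (Suc m) x (a 0) \<le> (1 - lam * h) * horizon_value g f lam h m ?x (a (Suc 0)) + h * f x (a 0)"
    unfolding horizon_value.simps using finite_grid_from grid_from_iff[OF assms(1)] Suc.prems
    by (intro Min_le finite_imageI imageI) auto
  also have "horizon_value g f lam h m ?x (a (Suc 0))
      \<le> (\<Sum>n<m. h * (1 - lam * h) ^ n * f (euler g h (\<lambda>i. a (Suc i)) ?x n) (a (Suc n)))"
    using Suc.prems by (intro Suc.IH)
  finally show ?case
    unfolding euler_cost_Suc using assms(4) by (simp add: mult_left_mono)
qed simp

lemma horizon_value_attained:
  assumes "h > 0" "a \<in> grid h"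
  shows "\<exists>s. s 0 = a \<and> (\<forall>n. s n \<in> grid h) \<and> (\<forall>n. s n \<le> s (Suc n)) \<and>
    horizon_value g f lam h m x a = (\<Sum>n<m. h * (1 - lam * h) ^ n * f (euler g h s x n) (s n))"
  using assms(2)
proof (induction m arbitrary: a x)
  case 0
  then show ?case by (intro exI[of _ "\<lambda>_. a"]) simp
next
  case (Suc m)
  let ?x = "x + h *\<^sub>R g x a"
  have "horizon_value g f lam h (Suc m) x a
      \<in> (\<lambda>b. (1 - lam * h) * horizon_value g f lam h m ?x b + h * f x a) ` grid_from h a"
    unfolding horizon_value.simps using finite_grid_from grid_from_nonempty[OF assms(1) Suc.prems]
    by (intro Min_in) auto
  then obtain b where b: "b \<in> grid_from h a"
    "horizon_value g f lam h (Suc m) x a = (1 - lam * h) * horizon_value g f lam h m ?x b + h * f x a" by auto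
  then obtain s where s: "s 0 = b" "\<forall>n. s n \<in> grid h" "\<forall>n. s n \<le> s (Suc n)"
    "horizon_value g f lam h m ?x b = (\<Sum>n<m. h * (1 - lam * h) ^ n * f (euler g h s ?x n) (s n))"
    using Suc.IH[of b ?x] grid_from_iff[OF assms(1)] by blast
  define t where "t = case_nat a s"
  have t: "t 0 = a" "t (Suc n) = s n" for n unfolding t_def by auto
  have "t n \<in> grid h" "t n \<le> t (Suc n)" for n
    using s b(1) Suc.prems grid_from_iff[OF assms(1)] by (cases n; simp add: t)+
  moreover have "horizon_value g f lam h (Suc m) x a = (\<Sum>n<Suc m. h * (1 - lam * h) ^ n * f (euler g h t x n) (t n))"
    unfolding euler_cost_Suc b(2) s(4) t ..
  ultimately show ?case using t(1) by blast
qed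

text \<open>A geometric series whose ratio satisfies \<open>r * (1 + \<delta> * h) \<le> 1\<close>.
  The factor \<open>1 + \<delta> * h\<close> allows for the excess of the left Riemann sum over the
  integral \<open>1 / \<delta>\<close>.\<close>

lemma sum_exp_neg_le:
  fixes h \<delta> :: real
  assumes "h > 0" "\<delta> > 0"
  shows "h * (\<Sum>n<m. exp (- \<delta> * (real n * h))) \<le> (1 + \<delta> * h) / \<delta>"
proof -
  define r where "r = exp (- \<delta> * h)"
  have r: "0 < r" "r < 1" unfolding r_def using assms by auto
  have "1 + \<delta> * h \<le> exp (\<delta> * h)" by (rule exp_ge_add_one_self)
  then have rr: "r * (1 + \<delta> * h) \<le> 1"
    unfolding r_def by (simp add: exp_minus field_simps)
  have pw: "exp (- \<delta> * (real n * h)) = r ^ n" for n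
    unfolding r_def by (simp add: exp_of_nat_mult[symmetric] mult.commute mult.left_commute)
  have "(\<Sum>n<m. r ^ n) = (1 - r ^ m) / (1 - r)"
    using r by (subst sum_gp_strict) auto
  also have "\<dots> \<le> 1 / (1 - r)" using r by (intro divide_right_mono) auto
  finally have "h * (\<Sum>n<m. r ^ n) \<le> h / (1 - r)" using assms mult_left_mono by fastforce
  also have "\<dots> \<le> (1 + \<delta> * h) / \<delta>"
    using rr assms r by (simp add: divide_simps) (simp add: algebra_simps)
  finally show ?thesis unfolding pw .
qed

context scheme
begin

lemma euler_in: "x \<in> D \<Longrightarrow> (\<And>n. s n \<in> grid h) \<Longrightarrow> euler g h s x n \<in> D"
proof (induction n)
  case (Suc n)
  then show ?case unfolding euler.simps by (intro step_in) auto
qed simp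

section \<open>Trajectories and integrability of the running cost\<close>

lemma trajectoryD:
  assumes "trajectory \<Omega> g x \<alpha> y"
  shows "y 0 = x" "continuous_on {0..} y" "0 \<le> s \<Longrightarrow> y s \<in> \<Omega>"
    "0 \<le> s \<Longrightarrow> ((\<lambda>r. g (y r) (\<alpha> r)) has_integral (y s - x)) {0..s}"
  using assms unfolding trajectory_def by auto

lemma controlsD:
  assumes "\<alpha> \<in> controls a"
  shows "0 \<le> s \<Longrightarrow> \<alpha> s \<in> {0..1}" "0 \<le> s \<Longrightarrow> s \<le> t \<Longrightarrow> \<alpha> s \<le> \<alpha> t" "a \<le> \<alpha> 0"
  using assms unfolding controls_def mono_on_def by (auto simp: Pi_def)

lemma trajectory_increment:
  assumes "trajectory \<Omega> g x \<alpha> y" "0 \<le> s" "s \<le> t"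
  shows "((\<lambda>r. g (y r) (\<alpha> r)) has_integral (y t - y s)) {s..t}"
proof -
  let ?f = "\<lambda>r. g (y r) (\<alpha> r)"
  have t: "(?f has_integral (y t - x)) {0..t}" and s: "(?f has_integral (y s - x)) {0..s}"
    using trajectoryD(4)[OF assms(1)] assms by auto
  have "integral {0..s} ?f + integral {s..t} ?f = integral {0..t} ?f"
    using assms t by (intro Henstock_Kurzweil_Integration.integral_combine) auto
  then have "integral {s..t} ?f = y t - y s"
    using t s by (simp add: integral_unique algebra_simps)
  moreover have "?f integrable_on {s..t}"
    by (rule integrable_on_subinterval[OF has_integral_integrable[OF t]]) (use assms in auto)
  ultimately show ?thesis by (simp add: has_integral_iff)
qed

lemma trajectory_lipschitz:
  assumes "trajectory \<Omega> g x \<alpha> y" "\<alpha> \<in> controls a" "0 \<le> s" "s \<le> t"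
  shows "norm (y t - y s) \<le> M\<^sub>g * (t - s)"
proof -
  have "norm (y t - y s) \<le> M\<^sub>g * measure lborel {s..t}"
  proof (rule has_integral_bound_real[OF _ finite.emptyI trajectory_increment[OF assms(1,3,4)]])
    fix r assume "r \<in> {s..t} - {}"
    then show "norm (g (y r) (\<alpha> r)) \<le> M\<^sub>g"
      using assms by (intro bounded_lipschitzD(1)[OF g_lip] trajectoryD(3) controlsD(1)) auto
  qed (use M\<^sub>g_pos in auto)
  then show ?thesis using assms by simp
qed

definition running :: "(real \<Rightarrow> real) \<Rightarrow> (real \<Rightarrow> real^'n) \<Rightarrow> real \<Rightarrow> real" where
  "running \<alpha> y s = f (y s) (\<alpha> s) * exp (- lam * s)"

lemma running_bound:
  assumes "trajectory \<Omega> g x \<alpha> y" "\<alpha> \<in> controls a" "0 \<le> s"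
  shows "\<bar>running \<alpha> y s\<bar> \<le> M\<^sub>f * exp (- lam * s)"
  unfolding running_def
  using bounded_lipschitzD(1)[OF f_lip trajectoryD(3)[OF assms(1,3)] controlsD(1)[OF assms(2,3)]]
  by (simp add: abs_mult mult_right_mono)

lemma f_continuous: "continuous_on (\<Omega> \<times> {0..1}) (\<lambda>(x, a). f x a)"
proof (rule continuous_on_iff[THEN iffD2], intro ballI allI impI)
  fix z :: "(real^'n) \<times> real" and e :: real
  assume "z \<in> \<Omega> \<times> {0..1}" "0 < e"
  then obtain x a where z: "z = (x, a)" "x \<in> \<Omega>" "a \<in> {0..1}" by auto
  have "dist (f x' a') (f x a) < e"
    if "x' \<in> \<Omega>" "a' \<in> {0..1}" "dist (x', a') (x, a) < e / (2 * L\<^sub>f)" for x' a'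
  proof -
    have "norm (x' - x) \<le> dist (x', a') (x, a)" "\<bar>a' - a\<bar> \<le> dist (x', a') (x, a)"
      using dist_fst_le[of "(x', a')" "(x, a)"] dist_snd_le[of "(x', a')" "(x, a)"]
      by (auto simp: dist_norm)
    moreover have "2 * dist (x', a') (x, a) < e / L\<^sub>f" using that(3) by simp
    ultimately have "norm (x' - x) + \<bar>a' - a\<bar> < e / L\<^sub>f" by linarith
    then have "L\<^sub>f * (norm (x' - x) + \<bar>a' - a\<bar>) < e"
      using L\<^sub>f_pos by (simp add: pos_less_divide_eq mult.commute)
    then show ?thesis
      using bounded_lipschitzD(2)[OF f_lip that(1,2) z(2,3)] by (simp add: dist_norm)
  qed
  then show "\<exists>d>0. \<forall>z'\<in>\<Omega> \<times> {0..1}. dist z' z < d \<longrightarrow>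
      dist (case z' of (x, a) \<Rightarrow> f x a) (case z of (x, a) \<Rightarrow> f x a) < e"
    unfolding z(1) using \<open>0 < e\<close> L\<^sub>f_pos by (intro exI[of _ "e / (2 * L\<^sub>f)"]) auto
qed

text \<open>Controls may jump, but being monotone they are Borel measurable. With \<open>y\<close>
  continuous and \<open>f\<close> jointly continuous the integrand is measurable, and
  \<open>M\<^sub>f * exp (- lam * s)\<close> dominates it.\<close>

lemma running_integrable:
  assumes y: "trajectory \<Omega> g x \<alpha> y" and \<alpha>: "\<alpha> \<in> controls a" and t: "0 \<le> t"
  shows "running \<alpha> y integrable_on {t..}"
proof (rule measurable_bounded_by_integrable_imp_integrable)
  have [measurable]: "y \<in> borel_measurable (restrict_space borel {0..})"
    using trajectoryD(2)[OF y] by (rule borel_measurable_continuous_on_restrict)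
  have [measurable]: "\<alpha> \<in> borel_measurable (restrict_space borel {0..})"
    using \<alpha> unfolding controls_def by (intro borel_measurable_mono_on_fnc) auto
  have "(\<lambda>s. (y s, \<alpha> s)) \<in> measurable (restrict_space borel {0..}) (restrict_space borel (\<Omega> \<times> {0..1}))"
  proof (rule measurable_restrict_space2)
    show "(\<lambda>s. (y s, \<alpha> s)) \<in> space (restrict_space borel {0..}) \<rightarrow> \<Omega> \<times> {0..1}"
      using trajectoryD(3)[OF y] controlsD(1)[OF \<alpha>] by (auto simp: space_restrict_space)
    show "(\<lambda>s. (y s, \<alpha> s)) \<in> borel_measurable (restrict_space borel {0..})"
      by (rule borel_measurable_Pair) measurable
  qed
  from measurable_compose[OF this borel_measurable_continuous_on_restrict[OF f_continuous]]
  have [measurable]: "(\<lambda>s. f (y s) (\<alpha> s)) \<in> borel_measurable (restrict_space borel {0..})" by simp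
  have "(\<lambda>s. exp (- lam * s)) \<in> borel_measurable (restrict_space borel {0..})"
    by (intro borel_measurable_continuous_on_restrict continuous_intros)
  then have "running \<alpha> y \<in> borel_measurable (restrict_space borel {0..})"
    unfolding running_def by measurable
  then have "(\<lambda>s. indicator {0..} s *\<^sub>R running \<alpha> y s) \<in> borel_measurable lborel"
    by (simp add: borel_measurable_restrict_space_iff)
  then have "(\<lambda>s. indicator {0..} s *\<^sub>R running \<alpha> y s) \<in> borel_measurable lebesgue"
    by (rule measurable_completion)
  then have "running \<alpha> y \<in> borel_measurable (lebesgue_on {0..})"
    by (simp add: borel_measurable_restrict_space_iff)
  then show "running \<alpha> y \<in> borel_measurable (lebesgue_on {t..})"
    by (rule measurable_restrict_mono) (use t in auto)
  show "(\<lambda>s. M\<^sub>f * exp (- lam * s)) integrable_on {t..}"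
    using integrable_cmul[OF integrable_on_exp_minus_to_infinity[OF lam_pos, of t], of M\<^sub>f] by simp
  show "norm (running \<alpha> y s) \<le> M\<^sub>f * exp (- lam * s)" if "s \<in> {t..}" for s
    using running_bound[OF y \<alpha>] that t by simp
qed auto

section \<open>Discount factors and growth sums\<close>

definition decay :: "nat \<Rightarrow> real" where "decay n = exp (- lam * (real n * h))"

lemma decay_pos: "0 < decay n" "decay n \<le> 1"
  unfolding decay_def using lam_pos h_pos by auto

lemma decay_Suc: "decay (Suc n) = decay n * exp (- lam * h)"
  unfolding decay_def by (simp add: exp_add[symmetric] algebra_simps)

lemma decay_Suc_le: "decay (Suc n) * (1 + lam * h) \<le> decay n"
proof -
  have "1 + lam * h \<le> exp (lam * h)" by (rule exp_ge_add_one_self)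
  then have "decay (Suc n) * (1 + lam * h) \<le> decay (Suc n) * exp (lam * h)"
    using decay_pos by (intro mult_left_mono) (auto intro: less_imp_le)
  also have "\<dots> = decay n" unfolding decay_Suc by (simp add: exp_minus)
  finally show ?thesis .
qed

lemma power_q_le_decay: "q ^ n \<le> decay n"
proof -
  have "q \<le> exp (- lam * h)" unfolding q_def using exp_ge_add_one_self[of "- lam * h"] by simp
  then have "q ^ n \<le> exp (- lam * h) ^ n" using q_bounds by (intro power_mono) auto
  also have "\<dots> = decay n"
    unfolding decay_def by (simp add: exp_of_nat_mult[symmetric] mult.commute mult.left_commute)
  finally show ?thesis .
qed

lemma exp_has_integral:
  "((\<lambda>s. exp (- lam * s)) has_integral (decay n - decay (Suc n)) / lam) {real n * h..real (Suc n) * h}"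
proof -
  have "((\<lambda>s. exp (- lam * s)) has_integral
      (- exp (- lam * (real (Suc n) * h)) / lam - (- exp (- lam * (real n * h)) / lam))) {real n * h..real (Suc n) * h}"
    using h_pos lam_pos
    by (intro fundamental_theorem_of_calculus)
       (auto intro!: derivative_eq_intros simp: has_real_derivative_iff_has_vector_derivative[symmetric])
  then show ?thesis unfolding decay_def by (simp add: diff_divide_distrib)
qed

text \<open>The negative parts of the summands are small, and their sum is nonpositive.\<close>

lemma sum_discount_error:
  "(\<Sum>n<m. \<bar>(decay n - decay (Suc n)) / lam - h * q ^ n\<bar>) \<le> 2 * h"
proof -
  let ?z = "\<lambda>n. (decay n - decay (Suc n)) / lam - h * q ^ n"
  \<comment> \<open>An absolute value is the number plus twice its negative part. The exact integral
    is at least \<open>h * q ^ Suc n\<close>, so the negative part is at most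
    \<open>h * q ^ n - h * q ^ Suc n = lam * h * (h * q ^ n)\<close>.\<close>
  have "\<bar>?z n\<bar> \<le> ?z n + 2 * (lam * h * (h * q ^ n))" for n
  proof -
    have "h * q ^ Suc n * lam = lam * h * q ^ Suc n" by simp
    also have "\<dots> \<le> lam * h * decay (Suc n)"
      using lam_pos h_pos by (intro mult_left_mono power_q_le_decay) auto
    also have "\<dots> \<le> decay n - decay (Suc n)"
      using decay_Suc_le[of n] by (simp add: algebra_simps)
    finally have "h * q ^ Suc n \<le> (decay n - decay (Suc n)) / lam"
      using lam_pos by (simp only: pos_le_divide_eq)
    moreover have "h * q ^ Suc n = h * q ^ n - lam * h * (h * q ^ n)"
      unfolding q_def by (simp add: algebra_simps)
    moreover have "0 \<le> lam * h * (h * q ^ n)" using lam_pos h_pos q_bounds by simp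
    ultimately show ?thesis by linarith
  qed
  then have "(\<Sum>n<m. \<bar>?z n\<bar>) \<le> (\<Sum>n<m. ?z n + 2 * (lam * h * (h * q ^ n)))"
    by (intro sum_mono)
  also have "\<dots> = (\<Sum>n<m. decay n - decay (Suc n)) / lam - h * (\<Sum>n<m. q ^ n) + 2 * lam * h * h * (\<Sum>n<m. q ^ n)"
    by (simp add: sum.distrib sum_subtractf sum_divide_distrib diff_divide_distrib sum_distrib_left mult.assoc)
  also have "(\<Sum>n<m. decay n - decay (Suc n)) = 1 - decay m"
    unfolding sum_lessThan_telescope' by (simp add: decay_def)
  also have "(\<Sum>n<m. q ^ n) = (1 - q ^ m) / (lam * h)"
    using q_bounds by (subst sum_gp_strict) (auto simp: q_def)
  also have "(1 - decay m) / lam - h * ((1 - q ^ m) / (lam * h)) + 2 * lam * h * h * ((1 - q ^ m) / (lam * h))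
      = (q ^ m - decay m) / lam + 2 * h * (1 - q ^ m)"
    using lam_pos h_pos by (simp add: field_simps)
  also have "\<dots> \<le> 0 + 2 * h * 1"
    using power_q_le_decay[of m] lam_pos h_pos q_bounds
    by (intro add_mono mult_left_mono) (auto simp: divide_nonpos_pos)
  finally show ?thesis by simp
qed

text \<open>Left Riemann sum of \<open>exp ((L\<^sub>g - lam) * t)\<close> over the horizon: the
  discounted amplification of state errors. Noise and Euler error are both measured by it, so the
  cases differ only in its size and in the horizon chosen for it.\<close>

definition growth :: "nat \<Rightarrow> real" where
  "growth m = h * (\<Sum>n<m. exp ((L\<^sub>g - lam) * (real n * h)))"

lemma growth_nonneg: "0 \<le> growth m"
  unfolding growth_def using h_pos by (intro mult_nonneg_nonneg sum_nonneg) auto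

lemma decay_rho_le: "decay n * \<rho> ^ n \<le> exp ((L\<^sub>g - lam) * (real n * h))"
proof -
  have "\<rho> \<le> exp (L\<^sub>g * h)" unfolding \<rho>_def by (rule exp_ge_add_one_self)
  then have "\<rho> ^ n \<le> exp (L\<^sub>g * h) ^ n" using rho_gt_1 by (intro power_mono) auto
  then have "decay n * \<rho> ^ n \<le> decay n * exp (L\<^sub>g * h) ^ n"
    using decay_pos[of n] by (intro mult_left_mono) auto
  also have "\<dots> = exp ((L\<^sub>g - lam) * (real n * h))"
    unfolding decay_def by (simp add: exp_of_nat_mult[symmetric] exp_add[symmetric] algebra_simps)
  finally show ?thesis .
qed

lemma sum_decay_rho_le: "h * (\<Sum>n<m. decay n * \<rho> ^ n) \<le> growth m"
  unfolding growth_def using h_pos decay_rho_le by (intro mult_left_mono sum_mono) auto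

lemma sum_q_rho_le: "h * (\<Sum>n<m. (q * \<rho>) ^ n) \<le> growth m"
proof -
  have "(\<Sum>n<m. (q * \<rho>) ^ n) \<le> (\<Sum>n<m. decay n * \<rho> ^ n)"
    unfolding power_mult_distrib using power_q_le_decay rho_gt_1 by (intro sum_mono mult_right_mono) auto
  then have "h * (\<Sum>n<m. (q * \<rho>) ^ n) \<le> h * (\<Sum>n<m. decay n * \<rho> ^ n)"
    using h_pos by (intro mult_left_mono) auto
  then show ?thesis using sum_decay_rho_le[of m] by linarith
qed

lemma sum_decay_le: "h * (\<Sum>n<m. decay n) \<le> 2 / lam"
proof -
  have "h * (\<Sum>n<m. decay n) \<le> (1 + lam * h) / lam"
    unfolding decay_def using sum_exp_neg_le[OF h_pos lam_pos] .
  also have "\<dots> \<le> 2 / lam" using lam_h lam_pos by (intro divide_right_mono) auto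
  finally show ?thesis .
qed

end

text \<open>
  A control \<open>\<alpha>\<close>, its trajectory \<open>y\<close> and an Euler path with the grid controls \<open>s\<close>.  Since
  \<open>\<alpha>\<close> is monotone with values in \<open>[0,1]\<close>, its oscillations \<open>d n\<close> over the time steps have a
  bounded sum, which makes the Euler error of order \<open>h\<close> in spite of the jumps.
\<close>

locale control_approximation = scheme +
  fixes x and \<alpha> :: "real \<Rightarrow> real" and a :: real and y
    and s :: "nat \<Rightarrow> real" and d :: "nat \<Rightarrow> real"
  assumes x_in: "x \<in> \<Union>\<T>" and control: "\<alpha> \<in> controls a" and traj: "trajectory \<Omega> g x \<alpha> y"
    and s_grid: "\<And>n. s n \<in> grid h" and d_nonneg: "\<And>n. 0 \<le> d n" and d_sum: "\<And>m. (\<Sum>n<m. d n) \<le> 2"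
    and near: "\<And>n r. real n * h \<le> r \<Longrightarrow> r \<le> real (Suc n) * h \<Longrightarrow> \<bar>\<alpha> r - s n\<bar> \<le> h + d n"
begin

section \<open>Error of the Euler path and of its cost\<close>

abbreviation "Y \<equiv> euler g h s x"
definition "err n = norm (y (real n * h) - Y n)"

lemma Y_in: "Y n \<in> \<Omega>"
  by (rule subsetD[OF D_subset euler_in[OF x_in s_grid]])

lemma near_point:
  assumes "r \<in> {real n * h..real (Suc n) * h}"
  shows "y r \<in> \<Omega>" "\<alpha> r \<in> {0..1}" "norm (y r - Y n) + \<bar>\<alpha> r - s n\<bar> \<le> err n + (M\<^sub>g + 1) * h + d n"
proof -
  have r0: "0 \<le> real n * h" using h_pos by simp
  moreover have "real n * h \<le> r" using assms by simp
  ultimately have "0 \<le> r" by (rule order_trans)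
  then show "y r \<in> \<Omega>" "\<alpha> r \<in> {0..1}" using trajectoryD(3)[OF traj] controlsD(1)[OF control] by auto
  have "norm (y r - y (real n * h)) \<le> M\<^sub>g * (r - real n * h)"
    using r0 assms by (intro trajectory_lipschitz[OF traj control]) auto
  also have "\<dots> \<le> M\<^sub>g * h"
    using assms M\<^sub>g_pos by (intro mult_left_mono) (auto simp: algebra_simps)
  finally have "norm (y r - Y n) \<le> M\<^sub>g * h + err n"
    unfolding err_def using norm_triangle_ineq[of "y r - y (real n * h)" "y (real n * h) - Y n"] by simp
  then show "norm (y r - Y n) + \<bar>\<alpha> r - s n\<bar> \<le> err n + (M\<^sub>g + 1) * h + d n"
    using near[of n r] assms by (simp add: algebra_simps)
qed

text \<open>During one step the state moves by at most \<open>M\<^sub>g * h\<close> and the control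
  stays within \<open>h + d n\<close> of \<open>s n\<close>; this bounds the deviation of the
  velocity from its frozen value.\<close>

lemma err_Suc: "err (Suc n) \<le> \<rho> * err n + L\<^sub>g * h * ((M\<^sub>g + 1) * h + d n)"
proof -
  let ?I = "{real n * h..real (Suc n) * h}"
  let ?B = "L\<^sub>g * (err n + (M\<^sub>g + 1) * h + d n)"
  let ?\<Delta> = "y (real (Suc n) * h) - y (real n * h) - h *\<^sub>R g (Y n) (s n)"
  have le: "real n * h \<le> real (Suc n) * h" using h_pos by simp
  have "((\<lambda>r. g (y r) (\<alpha> r) - g (Y n) (s n)) has_integral
      (y (real (Suc n) * h) - y (real n * h) - measure lborel ?I *\<^sub>R g (Y n) (s n))) ?I"
    using le h_pos by (intro has_integral_diff trajectory_increment[OF traj] has_integral_const_real) auto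
  moreover have "measure lborel ?I = h" using le by (simp add: algebra_simps)
  ultimately have "((\<lambda>r. g (y r) (\<alpha> r) - g (Y n) (s n)) has_integral ?\<Delta>) ?I" by simp
  moreover have "norm (g (y r) (\<alpha> r) - g (Y n) (s n)) \<le> ?B" if "r \<in> ?I - {}" for r
  proof -
    have r: "r \<in> ?I" using that by simp
    show ?thesis
      using bounded_lipschitzD(2)[OF g_lip near_point(1,2)[OF r] Y_in grid_01[OF s_grid], of n n]
        mult_left_mono[OF near_point(3)[OF r], of L\<^sub>g] L\<^sub>g_pos by linarith
  qed
  moreover have "0 \<le> ?B"
    using L\<^sub>g_pos M\<^sub>g_pos h_pos d_nonneg[of n] unfolding err_def by (intro mult_nonneg_nonneg add_nonneg_nonneg) auto
  ultimately have "norm ?\<Delta> \<le> ?B * measure lborel ?I"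
    by (intro has_integral_bound_real[OF _ finite.emptyI])
  then have "norm ?\<Delta> \<le> ?B * h" using \<open>measure lborel ?I = h\<close> by simp
  moreover have "y (real (Suc n) * h) - Y (Suc n) = (y (real n * h) - Y n) + ?\<Delta>" by simp
  then have "err (Suc n) \<le> err n + norm ?\<Delta>"
    unfolding err_def by (metis norm_triangle_ineq)
  ultimately show ?thesis unfolding \<rho>_def by (simp add: algebra_simps)
qed

text \<open>Discrete Gronwall. As \<open>\<rho> - 1 = L\<^sub>g * h\<close>, the constant parts of
  the local errors add up to \<open>(M\<^sub>g + 1) * h * (\<rho> ^ n - 1)\<close>, while the
  oscillations enter only through their sum, at most 2.\<close>

lemma err_le: "err n \<le> (M\<^sub>g + 1 + 2 * L\<^sub>g) * h * \<rho> ^ n"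
proof -
  have "err n \<le> (M\<^sub>g + 1) * h * (\<rho> ^ n - 1) + \<rho> ^ n * L\<^sub>g * h * (\<Sum>j<n. d j)"
  proof (induction n)
    case 0
    then show ?case using trajectoryD(1)[OF traj] by (simp add: err_def)
  next
    case (Suc n)
    have "err (Suc n) \<le> \<rho> * ((M\<^sub>g + 1) * h * (\<rho> ^ n - 1) + \<rho> ^ n * L\<^sub>g * h * (\<Sum>j<n. d j))
        + L\<^sub>g * h * ((M\<^sub>g + 1) * h + d n)"
      using err_Suc[of n] mult_left_mono[OF Suc.IH, of \<rho>] rho_gt_1 by linarith
    also have "\<dots> = (M\<^sub>g + 1) * h * (\<rho> ^ Suc n - 1) + \<rho> ^ Suc n * L\<^sub>g * h * (\<Sum>j<n. d j) + L\<^sub>g * h * d n"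
    proof -
      have "\<rho> * ((M\<^sub>g + 1) * h * (\<rho> ^ n - 1)) = (M\<^sub>g + 1) * h * (\<rho> ^ Suc n - 1) - L\<^sub>g * h * ((M\<^sub>g + 1) * h)"
        by (simp add: \<rho>_def algebra_simps)
      then show ?thesis by (simp add: distrib_left mult.assoc)
    qed
    also have "L\<^sub>g * h * d n \<le> \<rho> ^ Suc n * (L\<^sub>g * h * d n)"
      using mult_right_mono[of 1 "\<rho> ^ Suc n" "L\<^sub>g * h * d n"] one_le_power[of \<rho> "Suc n"]
        rho_gt_1 L\<^sub>g_pos h_pos d_nonneg[of n] by simp
    finally show ?case by (simp add: distrib_left mult.assoc)
  qed
  also have "\<dots> \<le> (M\<^sub>g + 1) * h * \<rho> ^ n + \<rho> ^ n * L\<^sub>g * h * 2"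
    using d_sum[of n] rho_gt_1 L\<^sub>g_pos M\<^sub>g_pos h_pos by (intro add_mono mult_left_mono) auto
  finally show ?thesis by (simp add: algebra_simps)
qed

text \<open>Two replacements: state and control in \<open>f\<close> are frozen, weighted by the
  largest discount \<open>decay n\<close> of the step, and then the exact integral of the
  exponential is replaced by \<open>h * q ^ n\<close>.\<close>

lemma step_cost:
  "\<bar>integral {real n * h..real (Suc n) * h} (running \<alpha> y) - h * q ^ n * f (Y n) (s n)\<bar>
   \<le> h * decay n * L\<^sub>f * (err n + (M\<^sub>g + 1) * h + d n)
     + M\<^sub>f * \<bar>(decay n - decay (Suc n)) / lam - h * q ^ n\<bar>"
proof -
  let ?I = "{real n * h..real (Suc n) * h}"
  let ?B = "L\<^sub>f * (err n + (M\<^sub>g + 1) * h + d n)"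
  let ?c = "(decay n - decay (Suc n)) / lam"
  let ?f = "f (Y n) (s n)"
  have le: "0 \<le> real n * h" "real n * h \<le> real (Suc n) * h" using h_pos by auto
  have "?I \<subseteq> {0..}" using le by auto
  then have "running \<alpha> y integrable_on ?I"
    by (rule integrable_on_subinterval[OF running_integrable[OF traj control order_refl]])
  then have "((\<lambda>r. running \<alpha> y r - ?f * exp (- lam * r)) has_integral
      (integral ?I (running \<alpha> y) - ?f * ?c)) ?I"
    by (intro has_integral_diff has_integral_mult_right exp_has_integral) (rule integrable_integral)
  moreover have "norm (running \<alpha> y r - ?f * exp (- lam * r)) \<le> decay n * ?B" if "r \<in> ?I - {}" for r
  proof -
    have r: "r \<in> ?I" using that by simp
    have "\<bar>f (y r) (\<alpha> r) - ?f\<bar> \<le> ?B"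
      using bounded_lipschitzD(2)[OF f_lip near_point(1,2)[OF r] Y_in grid_01[OF s_grid], of n n]
        mult_left_mono[OF near_point(3)[OF r], of L\<^sub>f] L\<^sub>f_pos unfolding real_norm_def by linarith
    moreover have "exp (- lam * r) \<le> decay n"
      unfolding decay_def using r lam_pos by simp
    ultimately have "exp (- lam * r) * \<bar>f (y r) (\<alpha> r) - ?f\<bar> \<le> decay n * ?B"
      using decay_pos[of n] by (intro mult_mono) auto
    moreover have "running \<alpha> y r - ?f * exp (- lam * r) = exp (- lam * r) * (f (y r) (\<alpha> r) - ?f)"
      unfolding running_def by (simp add: algebra_simps)
    ultimately show ?thesis by (simp add: abs_mult)
  qed
  moreover have "0 \<le> decay n * ?B"
    using L\<^sub>f_pos M\<^sub>g_pos h_pos d_nonneg[of n] decay_pos[of n] unfolding err_def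
    by (intro mult_nonneg_nonneg add_nonneg_nonneg) auto
  ultimately have "norm (integral ?I (running \<alpha> y) - ?f * ?c) \<le> decay n * ?B * measure lborel ?I"
    by (intro has_integral_bound_real[OF _ finite.emptyI])
  moreover have "measure lborel ?I = h" using le by (simp add: algebra_simps)
  ultimately have 1: "\<bar>integral ?I (running \<alpha> y) - ?f * ?c\<bar> \<le> h * decay n * ?B"
    by (simp add: mult.commute mult.left_commute)
  have "\<bar>?f\<bar> \<le> M\<^sub>f"
    using bounded_lipschitzD(1)[OF f_lip Y_in grid_01[OF s_grid], of n n] by simp
  then have 2: "\<bar>?f * (?c - h * q ^ n)\<bar> \<le> M\<^sub>f * \<bar>?c - h * q ^ n\<bar>"
    unfolding abs_mult by (intro mult_right_mono) auto
  have "integral ?I (running \<alpha> y) - h * q ^ n * ?f = (integral ?I (running \<alpha> y) - ?f * ?c) + ?f * (?c - h * q ^ n)"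
    by (simp add: algebra_simps)
  then show ?thesis using 1 2 by (simp add: mult.assoc)
qed

lemma integral_steps:
  "integral {0..real m * h} (running \<alpha> y) = (\<Sum>n<m. integral {real n * h..real (Suc n) * h} (running \<alpha> y))"
proof (induction m)
  case (Suc m)
  have "running \<alpha> y integrable_on {0..real (Suc m) * h}"
    by (rule integrable_on_subinterval[OF running_integrable[OF traj control order_refl]]) auto
  then have "integral {0..real m * h} (running \<alpha> y) + integral {real m * h..real (Suc m) * h} (running \<alpha> y)
      = integral {0..real (Suc m) * h} (running \<alpha> y)"
    using h_pos by (intro Henstock_Kurzweil_Integration.integral_combine) auto
  then show ?case using Suc by simp
qed simp

lemma tail_cost:
  "\<bar>integral {0..} (running \<alpha> y) - integral {0..real m * h} (running \<alpha> y)\<bar> \<le> M\<^sub>f / lam * decay m"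
proof -
  let ?t = "real m * h"
  have t: "0 \<le> ?t" using h_pos by simp
  note int = running_integrable[OF traj control order_refl]
  have Un: "{0..} = {0..?t} \<union> {?t..}" using t by auto
  have neg: "negligible ({0..?t} \<inter> {?t..})"
    by (rule negligible_subset[of "{?t}"]) auto
  have i1: "running \<alpha> y integrable_on {0..?t}"
    by (rule integrable_on_subinterval[OF int]) auto
  have i2: "running \<alpha> y integrable_on {?t..}"
    by (rule running_integrable[OF traj control t])
  have ie: "((\<lambda>r. M\<^sub>f * exp (- lam * r)) has_integral M\<^sub>f * (exp (- lam * ?t) / lam)) {?t..}"
    by (intro has_integral_mult_right has_integral_exp_minus_to_infinity lam_pos)
  have "integral {0..} (running \<alpha> y) = integral {0..?t} (running \<alpha> y) + integral {?t..} (running \<alpha> y)"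
    unfolding Un using i1 i2 neg by (rule integral_Un)
  moreover have "norm (integral {?t..} (running \<alpha> y)) \<le> integral {?t..} (\<lambda>r. M\<^sub>f * exp (- lam * r))"
  proof (rule Henstock_Kurzweil_Integration.integral_norm_bound_integral[OF i2])
    show "(\<lambda>r. M\<^sub>f * exp (- lam * r)) integrable_on {?t..}" using ie by blast
    show "norm (running \<alpha> y r) \<le> M\<^sub>f * exp (- lam * r)" if "r \<in> {?t..}" for r
      using running_bound[OF traj control, of r] that t by simp
  qed
  ultimately show ?thesis
    using integral_unique[OF ie] unfolding decay_def by simp
qed

end

section \<open>Rates of convergence\<close>

context control_approximation
begin

text \<open>\<open>growth m\<close> collects the propagated state errors. Local motion is summed
  against the discount, oscillations and discount errors have bounded sums of their own, and the
  last term pays for the time after the horizon.\<close>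

lemma total_cost:
  "\<bar>integral {0..} (running \<alpha> y) - (\<Sum>n<m. h * q ^ n * f (Y n) (s n))\<bar>
    \<le> L\<^sub>f * (M\<^sub>g + 1 + 2 * L\<^sub>g) * (h * growth m)
      + (2 * L\<^sub>f * (M\<^sub>g + 1) / lam + 2 * L\<^sub>f + 2 * M\<^sub>f) * h + M\<^sub>f / lam * decay m"
proof -
  let ?C = "M\<^sub>g + 1 + 2 * L\<^sub>g"
  let ?J = "\<lambda>n. integral {real n * h..real (Suc n) * h} (running \<alpha> y)"
  let ?z = "\<lambda>n. \<bar>(decay n - decay (Suc n)) / lam - h * q ^ n\<bar>"
  have step: "\<bar>?J n - h * q ^ n * f (Y n) (s n)\<bar>
      \<le> L\<^sub>f * ?C * h * (h * (decay n * \<rho> ^ n)) + L\<^sub>f * (M\<^sub>g + 1) * h * (h * decay n) + L\<^sub>f * h * d n + M\<^sub>f * ?z n" for n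
  proof -
    have "h * decay n * L\<^sub>f * (err n + (M\<^sub>g + 1) * h + d n)
        = h * decay n * L\<^sub>f * err n + L\<^sub>f * (M\<^sub>g + 1) * h * (h * decay n) + L\<^sub>f * h * (decay n * d n)"
      by (simp add: algebra_simps)
    also have "h * decay n * L\<^sub>f * err n \<le> h * decay n * L\<^sub>f * (?C * h * \<rho> ^ n)"
      using err_le[of n] decay_pos[of n] h_pos L\<^sub>f_pos by (intro mult_left_mono) auto
    also have "\<dots> = L\<^sub>f * ?C * h * (h * (decay n * \<rho> ^ n))" by simp
    also have "L\<^sub>f * h * (decay n * d n) \<le> L\<^sub>f * h * d n"
      using decay_pos[of n] d_nonneg[of n] h_pos L\<^sub>f_pos
      by (intro mult_left_mono mult_left_le_one_le) auto
    finally show ?thesis using step_cost[of n] by simp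
  qed
  have "\<bar>integral {0..real m * h} (running \<alpha> y) - (\<Sum>n<m. h * q ^ n * f (Y n) (s n))\<bar>
      \<le> (\<Sum>n<m. \<bar>?J n - h * q ^ n * f (Y n) (s n)\<bar>)"
    unfolding integral_steps sum_subtractf[symmetric] by (rule sum_abs)
  also have "\<dots> \<le> (\<Sum>n<m. L\<^sub>f * ?C * h * (h * (decay n * \<rho> ^ n)) + L\<^sub>f * (M\<^sub>g + 1) * h * (h * decay n)
      + L\<^sub>f * h * d n + M\<^sub>f * ?z n)"
    by (intro sum_mono step)
  also have "\<dots> = L\<^sub>f * ?C * h * (h * (\<Sum>n<m. decay n * \<rho> ^ n)) + L\<^sub>f * (M\<^sub>g + 1) * h * (h * (\<Sum>n<m. decay n))
      + L\<^sub>f * h * (\<Sum>n<m. d n) + M\<^sub>f * (\<Sum>n<m. ?z n)"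
    unfolding sum.distrib sum_distrib_left ..
  also have "\<dots> \<le> L\<^sub>f * ?C * h * growth m + L\<^sub>f * (M\<^sub>g + 1) * h * (2 / lam) + L\<^sub>f * h * 2 + M\<^sub>f * (2 * h)"
    using sum_decay_rho_le[of m] sum_decay_le[of m] d_sum[of m] sum_discount_error[of m]
      h_pos L\<^sub>f_pos M\<^sub>f_pos M\<^sub>g_pos L\<^sub>g_pos
    by (intro add_mono mult_left_mono) auto
  also have "\<dots> = L\<^sub>f * ?C * (h * growth m) + (2 * L\<^sub>f * (M\<^sub>g + 1) / lam + 2 * L\<^sub>f + 2 * M\<^sub>f) * h"
    by (simp add: algebra_simps add_divide_distrib)
  finally show ?thesis using tail_cost[of m] by linarith
qed

end

text \<open>The sum of the coefficients in \<open>total_cost\<close>, \<open>W_horizon\<close> and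
  \<open>rho_sqrt_noise_le\<close>. \<open>M\<^sub>f / lam\<close> counts twice, because the value
  function and the discrete solution are both truncated.\<close>

definition error_const :: "real \<Rightarrow> real \<Rightarrow> real \<Rightarrow> real \<Rightarrow> real \<Rightarrow> real" where
  "error_const lam L\<^sub>g M\<^sub>g L\<^sub>f M\<^sub>f =
     L\<^sub>f * (M\<^sub>g + 1 + 2 * L\<^sub>g) + (2 * L\<^sub>f * (M\<^sub>g + 1) / lam + 2 * L\<^sub>f + 2 * M\<^sub>f) + 2 * (M\<^sub>f / lam)
     + L\<^sub>f * ((1 + L\<^sub>g / lam) / sqrt (2 * L\<^sub>g))"

lemma error_const_pos:
  assumes "lam > 0" "L\<^sub>g > 0" "M\<^sub>g > 0" "L\<^sub>f > 0" "M\<^sub>f > 0"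
  shows "error_const lam L\<^sub>g M\<^sub>g L\<^sub>f M\<^sub>f > 0"
proof -
  have "0 < L\<^sub>f * (M\<^sub>g + 1 + 2 * L\<^sub>g)" "0 < 2 * L\<^sub>f * (M\<^sub>g + 1) / lam + 2 * L\<^sub>f + 2 * M\<^sub>f" "0 < 2 * (M\<^sub>f / lam)"
    using assms by (auto intro!: add_pos_pos mult_pos_pos divide_pos_pos)
  moreover have "0 < L\<^sub>f * ((1 + L\<^sub>g / lam) / sqrt (2 * L\<^sub>g))"
    using assms by (auto intro!: mult_pos_pos divide_pos_pos add_pos_pos)
  ultimately show ?thesis unfolding error_const_def by linarith
qed

section \<open>Passing between controls in continuous time and grid sequences\<close>

context scheme
begin

lemma trajectory_of_grid_control:
  assumes x: "x \<in> D" and s: "\<And>n. s n \<in> grid h" "\<And>n. s n \<le> s (Suc n)"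
    and ex: "\<And>\<alpha>. \<alpha> \<in> controls (s 0) \<Longrightarrow> \<exists>y. trajectory \<Omega> g x \<alpha> y"
  shows "\<exists>\<alpha> y. control_approximation \<T> k \<Omega> g f lam h L\<^sub>g M\<^sub>g L\<^sub>f M\<^sub>f x \<alpha> (s 0) y s (\<lambda>n. s (Suc n) - s n)"
proof -
  have mono: "s i \<le> s j" if "i \<le> j" for i j
    using lift_Suc_mono_le[of s, OF s(2) that] .
  have s01: "0 \<le> s n" "s n \<le> 1" for n using grid_01[OF s(1)[of n]] by auto
  \<comment> \<open>At the right end of step \<open>n\<close> this control already equals
    \<open>s (Suc n)\<close>, and \<open>near\<close> speaks of closed intervals; hence the
    increments of \<open>s\<close> serve as oscillations.\<close>
  define \<alpha> where "\<alpha> r = s (nat \<lfloor>r / h\<rfloor>)" for r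
  have "\<alpha> \<in> controls (s 0)"
    unfolding controls_def
  proof (intro CollectI conjI)
    show "mono_on {0..} \<alpha>"
      unfolding mono_on_def \<alpha>_def using h_pos
      by (auto intro!: mono nat_mono floor_mono divide_right_mono)
    show "\<alpha> \<in> {0..} \<rightarrow> {0..1}" unfolding \<alpha>_def using s01 by auto
    show "s 0 \<le> \<alpha> 0" unfolding \<alpha>_def by simp
  qed
  moreover from ex[OF this] obtain y where "trajectory \<Omega> g x \<alpha> y" ..
  moreover have "(\<Sum>n<m. s (Suc n) - s n) \<le> 2" for m
    unfolding sum_lessThan_telescope using s01(2)[of m] s01(1)[of 0] by simp
  moreover have "\<bar>\<alpha> r - s n\<bar> \<le> h + (s (Suc n) - s n)"
    if "real n * h \<le> r" "r \<le> real (Suc n) * h" for n r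
  proof -
    have "real n \<le> r / h" "r / h \<le> real (Suc n)"
      using that h_pos by (simp_all add: pos_le_divide_eq pos_divide_le_eq)
    then have "n \<le> nat \<lfloor>r / h\<rfloor>" "nat \<lfloor>r / h\<rfloor> \<le> Suc n"
      by (simp_all add: le_nat_floor nat_le_iff floor_le_iff)
    then have "s n \<le> \<alpha> r" "\<alpha> r \<le> s (Suc n)" unfolding \<alpha>_def by (auto intro: mono)
    then show ?thesis using h_pos by simp
  qed
  ultimately have "control_approximation \<T> k \<Omega> g f lam h L\<^sub>g M\<^sub>g L\<^sub>f M\<^sub>f x \<alpha> (s 0) y s (\<lambda>n. s (Suc n) - s n)"
    using x s by unfold_locales auto
  then show ?thesis by blast
qed

text \<open>Rounding the control down to the grid at the left end of each step preserves
  monotonicity and costs at most \<open>h\<close>.\<close>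

lemma grid_control_of_trajectory:
  assumes x: "x \<in> D" and a: "a \<in> grid h" and \<alpha>: "\<alpha> \<in> controls a" and y: "trajectory \<Omega> g x \<alpha> y"
  shows "\<exists>s d. s 0 = a \<and> (\<forall>n. s n \<le> s (Suc n)) \<and>
    control_approximation \<T> k \<Omega> g f lam h L\<^sub>g M\<^sub>g L\<^sub>f M\<^sub>f x \<alpha> a y s d"
proof -
  define t where "t n = real n * h" for n
  have t: "0 \<le> t n" "t n \<le> t (Suc n)" for n unfolding t_def using h_pos by auto
  have \<alpha>01: "0 \<le> \<alpha> (t n)" "\<alpha> (t n) \<le> 1" for n using controlsD(1)[OF \<alpha> t(1)[of n]] by auto
  have \<alpha>S: "\<alpha> (t n) \<le> \<alpha> (t (Suc n))" for n using controlsD(2)[OF \<alpha> t(1) t(2)] .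
  define i where "i n = nat \<lfloor>\<alpha> (t n) / h\<rfloor>" for n
  \<comment> \<open>\<open>horizon_value\<close> starts exactly at \<open>a\<close>, whereas a
    control may start anywhere above \<open>a\<close>. The initial mismatch is at most 1 and is
    charged to \<open>d 0\<close>; added to the variation of the control, it makes the sum of
    \<open>d\<close> at most 2.\<close>
  define s where "s n = (if n = 0 then a else real (i n) * h)" for n
  define d where "d n = (if n = 0 then 1 else 0) + (\<alpha> (t (Suc n)) - \<alpha> (t n))" for n
  have i: "real (i n) * h \<le> \<alpha> (t n)" "\<alpha> (t n) \<le> real (i n) * h + h" for n
  proof -
    have "0 \<le> \<alpha> (t n) / h" using \<alpha>01 h_pos by simp
    then have "real (i n) \<le> \<alpha> (t n) / h" "\<alpha> (t n) / h \<le> real (i n) + 1"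
      unfolding i_def by linarith+
    then show "real (i n) * h \<le> \<alpha> (t n)" "\<alpha> (t n) \<le> real (i n) * h + h"
      using h_pos by (simp_all add: pos_le_divide_eq pos_divide_le_eq distrib_right)
  qed
  obtain j :: nat where j: "a = real j * h" using a unfolding grid_def by auto
  \<comment> \<open>Rounding down cannot fall below \<open>a\<close>, because \<open>a\<close> is
    itself a grid point.\<close>
  have ja: "j \<le> i n" for n
  proof -
    have "a \<le> \<alpha> (t n)" using controlsD(3)[OF \<alpha>] controlsD(2)[OF \<alpha> order_refl t(1)[of n]] by simp
    then have "real j \<le> \<alpha> (t n) / h" unfolding j using h_pos by (simp add: pos_le_divide_eq)
    then show ?thesis unfolding i_def by (rule le_nat_floor)
  qed
  have iS: "i n \<le> i (Suc n)" for n
    unfolding i_def using \<alpha>S[of n] h_pos by (intro nat_mono floor_mono divide_right_mono) auto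
  have s: "s n \<le> s (Suc n)" for n
    unfolding s_def j using ja[of "Suc n"] iS[of n] h_pos by (auto intro: mult_right_mono)
  have sg: "s n \<in> grid h" for n
  proof (cases "n = 0")
    case False
    have "real (i n) \<le> 1 / h" using order_trans[OF i(1) \<alpha>01(2)[of n]] h_pos by (simp add: pos_le_divide_eq)
    then show ?thesis using False unfolding s_def grid_def by auto
  qed (use a in \<open>simp add: s_def\<close>)
  have dsum: "(\<Sum>n<m. d n) \<le> 2" for m
  proof -
    have "(\<Sum>n<m. d n) = (\<Sum>n<m. if n = 0 then 1 else 0) + (\<alpha> (t m) - \<alpha> (t 0))"
      unfolding d_def sum.distrib by (simp only: sum_lessThan_telescope[of "\<lambda>n. \<alpha> (t n)"])
    also have "(\<Sum>n<m. if n = 0 then 1 else 0) \<le> (1::real)" by (simp add: sum.delta)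
    finally show ?thesis using \<alpha>01(2)[of m] \<alpha>01(1)[of 0] by simp
  qed
  have near: "\<bar>\<alpha> r - s n\<bar> \<le> h + d n" if r: "real n * h \<le> r" "r \<le> real (Suc n) * h" for n r
  proof -
    have r': "t n \<le> r" "r \<le> t (Suc n)" "0 \<le> r" using r t(1)[of n] unfolding t_def by auto
    have 1: "\<alpha> (t n) \<le> \<alpha> r" "\<alpha> r \<le> \<alpha> (t (Suc n))"
      using controlsD(2)[OF \<alpha>] r' t(1)[of n] by auto
    show ?thesis
    proof (cases "n = 0")
      case True
      have "\<alpha> r \<in> {0..1}" using controlsD(1)[OF \<alpha>] r' by auto
      then show ?thesis using True grid_01[OF a] \<alpha>S[of 0] h_pos unfolding s_def d_def by auto
    next
      case False
      then show ?thesis using 1 i[of n] h_pos unfolding s_def d_def by auto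
    qed
  qed
  have "control_approximation \<T> k \<Omega> g f lam h L\<^sub>g M\<^sub>g L\<^sub>f M\<^sub>f x \<alpha> a y s d"
    using x \<alpha> y sg dsum near \<alpha>S by unfold_locales (auto simp: d_def)
  moreover have "s 0 = a" by (simp add: s_def)
  ultimately show ?thesis using s by blast
qed

text \<open>For the lower bound every control is matched with a grid sequence; for the upper bound
  an optimal grid sequence is turned into a step control. The lower bound also shows that the
  infimum is over a set bounded below.\<close>

lemma value_horizon:
  assumes ex: "\<And>\<alpha>. \<alpha> \<in> controls a \<Longrightarrow> \<exists>y. trajectory \<Omega> g x \<alpha> y"
    and x: "x \<in> D" and a: "a \<in> grid h"
  shows "\<bar>value_function \<Omega> g f lam x a - horizon_value g f lam h m x a\<bar>
    \<le> L\<^sub>f * (M\<^sub>g + 1 + 2 * L\<^sub>g) * (h * growth m)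
      + (2 * L\<^sub>f * (M\<^sub>g + 1) / lam + 2 * L\<^sub>f + 2 * M\<^sub>f) * h + M\<^sub>f / lam * decay m" (is "_ \<le> ?R")
proof -
  let ?U = "horizon_value g f lam h m x a"
  define S where "S = {integral {0..} (running \<alpha> y) | \<alpha> y. \<alpha> \<in> controls a \<and> trajectory \<Omega> g x \<alpha> y}"
  have v: "value_function \<Omega> g f lam x a = Inf S"
    unfolding value_function_def S_def running_def ..
  have lower: "?U - ?R \<le> c" if cS: "c \<in> S" for c
  proof -
    obtain \<alpha> y where c: "c = integral {0..} (running \<alpha> y)" "\<alpha> \<in> controls a" "trajectory \<Omega> g x \<alpha> y"
      using cS unfolding S_def by blast
    obtain s d where s: "s 0 = a" "\<And>n. s n \<le> s (Suc n)"
      and ca: "control_approximation \<T> k \<Omega> g f lam h L\<^sub>g M\<^sub>g L\<^sub>f M\<^sub>f x \<alpha> a y s d"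
      using grid_control_of_trajectory[OF x a c(2,3)] by blast
    interpret control_approximation \<T> k \<Omega> g f lam h L\<^sub>g M\<^sub>g L\<^sub>f M\<^sub>f x \<alpha> a y s d by (rule ca)
    have "?U \<le> (\<Sum>n<m. h * q ^ n * f (Y n) (s n))"
      unfolding s(1)[symmetric] q_def by (rule horizon_value_le[where a=s, OF h_pos s_grid s(2) lam_h])
    then show ?thesis using total_cost[of m] c(1) by linarith
  qed
  obtain s where s: "s 0 = a" "\<And>n. s n \<in> grid h" "\<And>n. s n \<le> s (Suc n)"
    and U: "?U = (\<Sum>n<m. h * q ^ n * f (euler g h s x n) (s n))"
    using horizon_value_attained[OF h_pos a, of g f lam m x] unfolding q_def by blast
  obtain \<alpha> y where
    ca: "control_approximation \<T> k \<Omega> g f lam h L\<^sub>g M\<^sub>g L\<^sub>f M\<^sub>f x \<alpha> a y s (\<lambda>n. s (Suc n) - s n)"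
    using trajectory_of_grid_control[where s=s, OF x s(2,3)] ex unfolding s(1) by blast
  interpret ca: control_approximation \<T> k \<Omega> g f lam h L\<^sub>g M\<^sub>g L\<^sub>f M\<^sub>f x \<alpha> a y s "\<lambda>n. s (Suc n) - s n"
    by (rule ca)
  have mem: "integral {0..} (running \<alpha> y) \<in> S"
    unfolding S_def using ca.control ca.traj by blast
  have "Inf S \<le> integral {0..} (running \<alpha> y)"
    using mem lower by (intro cInf_lower bdd_belowI) auto
  moreover have "integral {0..} (running \<alpha> y) \<le> ?U + ?R"
    using ca.total_cost[of m] U by linarith
  moreover have "?U - ?R \<le> Inf S" using mem lower by (intro cInf_greatest) auto
  ultimately show ?thesis unfolding v by linarith
qed

text \<open>Triangle inequality through \<open>horizon_value\<close>. The left-hand side is free of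
  \<open>m\<close>, so the horizon can be chosen afterwards.\<close>

lemma error_bound:
  assumes ex: "\<And>\<alpha>. \<alpha> \<in> controls a \<Longrightarrow> \<exists>y. trajectory \<Omega> g x \<alpha> y"
    and x: "x \<in> D" and a: "a \<in> grid h"
  shows "\<bar>value_function \<Omega> g f lam x a - W (x, a)\<bar>
    \<le> error_const lam L\<^sub>g M\<^sub>g L\<^sub>f M\<^sub>f * ((h + k / sqrt h) * growth m + h + decay m)"
proof -
  define A where "A = L\<^sub>f * (M\<^sub>g + 1 + 2 * L\<^sub>g)"
  define B where "B = 2 * L\<^sub>f * (M\<^sub>g + 1) / lam + 2 * L\<^sub>f + 2 * M\<^sub>f"
  define C where "C = M\<^sub>f / lam"
  define E where "E = L\<^sub>f * ((1 + L\<^sub>g / lam) / sqrt (2 * L\<^sub>g))"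
  define e where "e = k / sqrt h"
  define G where "G = growth m"
  have K: "error_const lam L\<^sub>g M\<^sub>g L\<^sub>f M\<^sub>f = A + B + 2 * C + E"
    unfolding error_const_def A_def B_def C_def E_def ..
  have pos: "0 \<le> A" "0 \<le> B" "0 \<le> C" "0 \<le> E" "0 \<le> e" "0 \<le> G" "0 \<le> decay m" "0 \<le> h"
    unfolding A_def B_def C_def E_def e_def G_def
    using lam_pos L\<^sub>g_pos M\<^sub>g_pos L\<^sub>f_pos M\<^sub>f_pos k_pos h_pos growth_nonneg decay_pos[of m] by auto
  have "\<bar>W (x, a) - horizon_value g f lam h m x a\<bar> \<le> L\<^sub>f * (h * (\<Sum>n<m. (q * \<rho>) ^ n)) * (\<rho> * sqrt noise) + q ^ m * C"
    using W_horizon[OF x a, of m] unfolding C_def by (simp only: mult.assoc mult.left_commute)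
  also have "\<dots> \<le> L\<^sub>f * G * ((1 + L\<^sub>g / lam) / sqrt (2 * L\<^sub>g) * e) + decay m * C"
  proof (rule add_mono)
    have 1: "L\<^sub>f * (h * (\<Sum>n<m. (q * \<rho>) ^ n)) \<le> L\<^sub>f * G"
      unfolding G_def using sum_q_rho_le L\<^sub>f_pos by (intro mult_left_mono) auto
    have 2: "0 \<le> L\<^sub>f * G" using L\<^sub>f_pos pos by simp
    have 3: "0 \<le> \<rho> * sqrt noise" using rho_gt_1 noise_pos by simp
    show "L\<^sub>f * (h * (\<Sum>n<m. (q * \<rho>) ^ n)) * (\<rho> * sqrt noise)
        \<le> L\<^sub>f * G * ((1 + L\<^sub>g / lam) / sqrt (2 * L\<^sub>g) * e)"
      unfolding e_def by (rule mult_mono[OF 1 rho_sqrt_noise_le 2 3])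
    show "q ^ m * C \<le> decay m * C" using power_q_le_decay pos(3) by (rule mult_right_mono)
  qed
  also have "\<dots> = E * (e * G) + C * decay m" unfolding E_def by simp
  finally have "\<bar>value_function \<Omega> g f lam x a - W (x, a)\<bar>
     \<le> A * (h * G) + B * h + C * decay m + (E * (e * G) + C * decay m)"
    using value_horizon[OF ex x a, of m] unfolding A_def B_def C_def G_def by linarith
  also have "\<dots> \<le> (A + B + 2 * C + E) * ((h + e) * G + h + decay m)"
  proof -
    \<comment> \<open>The difference expands into products of nonnegative quantities, which permits
      merging all coefficients into one constant.\<close>
    have "(A + B + 2 * C + E) * ((h + e) * G + h + decay m)
        - (A * (h * G) + B * h + C * decay m + (E * (e * G) + C * decay m))
        = A * (e * G) + A * h + A * decay m + B * (h * G) + B * (e * G) + B * decay m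
          + 2 * C * (h * G) + 2 * C * (e * G) + 2 * C * h + E * (h * G) + E * h + E * decay m"
      by (simp add: algebra_simps)
    also have "\<dots> \<ge> 0" using pos by simp
    finally show ?thesis by simp
  qed
  finally show ?thesis unfolding K e_def G_def .
qed

section \<open>Choice of the horizon\<close>

lemma growth_subcritical:
  assumes "L\<^sub>g < lam"
  shows "growth m \<le> 2 / (lam - L\<^sub>g)"
proof -
  have "(lam - L\<^sub>g) * h \<le> lam * h" using h_pos L\<^sub>g_pos by (intro mult_right_mono) auto
  then have "(1 + (lam - L\<^sub>g) * h) / (lam - L\<^sub>g) \<le> 2 / (lam - L\<^sub>g)"
    using lam_h assms by (intro divide_right_mono) auto
  then show ?thesis
    using sum_exp_neg_le[OF h_pos, of "lam - L\<^sub>g" m] assms unfolding growth_def by simp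
qed

text \<open>Each summand is at most the increment of
  \<open>exp ((L\<^sub>g - lam) * t) / (L\<^sub>g - lam)\<close> over its step, so the sum
  telescopes.\<close>

lemma growth_supercritical:
  assumes "lam < L\<^sub>g"
  shows "growth m \<le> exp ((L\<^sub>g - lam) * (real m * h)) / (L\<^sub>g - lam)"
proof -
  let ?\<delta> = "L\<^sub>g - lam"
  let ?E = "\<lambda>n. exp (?\<delta> * (real n * h))"
  have "h * ?E n \<le> (?E (Suc n) - ?E n) / ?\<delta>" for n
  proof -
    have "?E n * (1 + ?\<delta> * h) \<le> ?E n * exp (?\<delta> * h)"
      by (intro mult_left_mono exp_ge_add_one_self) simp
    also have "\<dots> = ?E (Suc n)" by (simp add: exp_add[symmetric] algebra_simps)
    finally have "h * ?E n * ?\<delta> \<le> ?E (Suc n) - ?E n" by (simp add: algebra_simps)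
    then show ?thesis using assms by (simp only: pos_le_divide_eq diff_gt_0_iff_gt)
  qed
  then have "growth m \<le> (\<Sum>n<m. (?E (Suc n) - ?E n) / ?\<delta>)"
    unfolding growth_def sum_distrib_left by (intro sum_mono)
  also have "\<dots> = (\<Sum>n<m. ?E (Suc n) - ?E n) / ?\<delta>"
    by (rule sum_divide_distrib[symmetric])
  also have "(\<Sum>n<m. ?E (Suc n) - ?E n) = ?E m - ?E 0" by (rule sum_lessThan_telescope)
  also have "(?E m - ?E 0) / ?\<delta> \<le> ?E m / ?\<delta>" using assms by (intro divide_right_mono) auto
  finally show ?thesis .
qed

lemma decay_tendsto: "decay \<longlonglongrightarrow> 0"
proof -
  have "decay = (\<lambda>n. exp (- lam * h) ^ n)"
    unfolding decay_def by (simp add: exp_of_nat_mult[symmetric] mult.commute mult.left_commute)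
  moreover have "(\<lambda>n. exp (- lam * h) ^ n) \<longlonglongrightarrow> 0"
    using lam_pos h_pos by (intro LIMSEQ_realpow_zero) auto
  ultimately show ?thesis by simp
qed

text \<open>\<open>growth m\<close> is bounded in \<open>m\<close>, so the horizon may tend to
  infinity and the truncation term disappears.\<close>

lemma error_subcritical:
  assumes ex: "\<And>\<alpha>. \<alpha> \<in> controls a \<Longrightarrow> \<exists>y. trajectory \<Omega> g x \<alpha> y"
    and x: "x \<in> D" and a: "a \<in> grid h" and "L\<^sub>g < lam"
  shows "\<bar>value_function \<Omega> g f lam x a - W (x, a)\<bar>
    \<le> error_const lam L\<^sub>g M\<^sub>g L\<^sub>f M\<^sub>f * (2 / (lam - L\<^sub>g) + 1) * (h + k / sqrt h)"
proof -
  let ?K = "error_const lam L\<^sub>g M\<^sub>g L\<^sub>f M\<^sub>f"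
  let ?e = "h + k / sqrt h"
  let ?v = "\<bar>value_function \<Omega> g f lam x a - W (x, a)\<bar>"
  have K: "?K > 0" by (rule error_const_pos) (fact lam_pos L\<^sub>g_pos M\<^sub>g_pos L\<^sub>f_pos M\<^sub>f_pos)+
  have e: "0 \<le> ?e" "h \<le> ?e" using h_pos k_pos by auto
  have "?v \<le> ?K * (?e * (2 / (lam - L\<^sub>g)) + ?e + decay m)" for m
  proof -
    have "?v \<le> ?K * (?e * growth m + h + decay m)" by (rule error_bound[OF ex x a])
    also have "\<dots> \<le> ?K * (?e * (2 / (lam - L\<^sub>g)) + ?e + decay m)"
      using K e growth_subcritical[OF assms(4), of m] by (intro mult_left_mono add_mono) auto
    finally show ?thesis .
  qed
  moreover have "(\<lambda>m. ?K * (?e * (2 / (lam - L\<^sub>g)) + ?e + decay m)) \<longlonglongrightarrow> ?K * (?e * (2 / (lam - L\<^sub>g)) + ?e + 0)"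
    by (intro tendsto_intros decay_tendsto)
  ultimately have "?v \<le> ?K * (?e * (2 / (lam - L\<^sub>g)) + ?e + 0)"
    by (intro LIMSEQ_le_const) auto
  also have "\<dots> = ?K * (2 / (lam - L\<^sub>g) + 1) * ?e" by (simp add: algebra_simps)
  finally show ?thesis .
qed

text \<open>
  The horizon is cut at the time \<open>T\<close> with \<open>exp (- L\<^sub>g T) = \<epsilon>\<close>, where the amplified
  discretization error \<open>\<epsilon> exp (L\<^sub>g T)\<close> reaches order one.
\<close>

lemma error_supercritical:
  assumes ex: "\<And>\<alpha>. \<alpha> \<in> controls a \<Longrightarrow> \<exists>y. trajectory \<Omega> g x \<alpha> y"
    and x: "x \<in> D" and a: "a \<in> grid h" and L: "lam < L\<^sub>g"
  shows "\<bar>value_function \<Omega> g f lam x a - W (x, a)\<bar>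
    \<le> error_const lam L\<^sub>g M\<^sub>g L\<^sub>f M\<^sub>f * (1 / (L\<^sub>g - lam) + 1 / lam + 4) * (h + k / sqrt h) powr (lam / L\<^sub>g)"
proof -
  define K where "K = error_const lam L\<^sub>g M\<^sub>g L\<^sub>f M\<^sub>f"
  define e where "e = h + k / sqrt h"
  define \<gamma> where "\<gamma> = lam / L\<^sub>g"
  define \<delta> where "\<delta> = L\<^sub>g - lam"
  let ?v = "\<bar>value_function \<Omega> g f lam x a - W (x, a)\<bar>"
  have K: "K > 0" unfolding K_def by (rule error_const_pos) (fact lam_pos L\<^sub>g_pos M\<^sub>g_pos L\<^sub>f_pos M\<^sub>f_pos)+
  have e: "0 < e" "h \<le> e" unfolding e_def using h_pos k_pos by (auto intro: add_pos_pos)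
  have \<gamma>: "0 < \<gamma>" "\<gamma> \<le> 1" unfolding \<gamma>_def using lam_pos L by auto
  have \<delta>: "0 < \<delta>" unfolding \<delta>_def using L by simp
  have bound: "?v \<le> K * (e * growth m + h + decay m)" for m
    unfolding K_def e_def by (rule error_bound[OF ex x a])
  have "\<exists>m. e * growth m + h + decay m \<le> (1 / \<delta> + 1 / lam + 4) * e powr \<gamma>"
  proof (cases "e \<ge> 1")
    \<comment> \<open>A large \<open>e\<close> asks only for boundedness of the error: horizon 0
      suffices, and \<open>h \<le> 1 / lam\<close> is the source of \<open>1 / lam\<close> in the
      constant.\<close>
    case True
    have aux: "h + 1 \<le> c + l + 4" if "h \<le> l" "0 < c" for c l :: real
      using that by linarith
    have "h \<le> 1 / lam" using lam_h lam_pos by (simp add: field_simps)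
    then have "e * growth 0 + h + decay 0 \<le> (1 / \<delta> + 1 / lam + 4) * 1"
      using aux[of "1 / lam" "1 / \<delta>"] \<delta> by (simp add: growth_def decay_def)
    also have "\<dots> \<le> (1 / \<delta> + 1 / lam + 4) * e powr \<gamma>"
      using True \<gamma> \<delta> lam_pos by (intro mult_left_mono ge_one_powr_ge_zero) auto
    finally show ?thesis by blast
  next
    case False
    define T where "T = - ln e / L\<^sub>g"
    \<comment> \<open>Rounding down keeps \<open>growth m\<close> below its bound at time
      \<open>T\<close> and costs a factor \<open>exp (lam * h)\<close>, at most 3, in
      \<open>decay m\<close>. The 4 in the constant is this 3 plus 1 for the term
      \<open>h\<close>.\<close>
    define m where "m = nat \<lfloor>T / h\<rfloor>"
    have T0: "0 \<le> T / h" unfolding T_def using False e L\<^sub>g_pos h_pos by (simp add: divide_nonpos_pos)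
    then have "real m \<le> T / h" "T / h \<le> real m + 1" unfolding m_def by linarith+
    then have m: "real m * h \<le> T" "T - h \<le> real m * h"
      using h_pos by (simp_all add: pos_le_divide_eq pos_divide_le_eq distrib_right)
    have pw: "e powr \<gamma> = exp (\<gamma> * ln e)" using e by (simp add: powr_def)
    have "growth m \<le> exp (\<delta> * T) / \<delta>"
      using growth_supercritical[OF L, of m] m(1) \<delta> unfolding \<delta>_def[symmetric]
      by (elim order_trans) (intro divide_right_mono, auto)
    then have "e * growth m \<le> e * (exp (\<delta> * T) / \<delta>)" using e by (intro mult_left_mono) auto
    also have "\<dots> = exp (ln e + \<delta> * T) / \<delta>" using e by (simp add: exp_add)
    \<comment> \<open>This \<open>T\<close> balances the two errors:
      \<open>e * exp (\<delta> * T)\<close> and \<open>exp (- lam * T)\<close> both equal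
      \<open>e powr \<gamma>\<close>.\<close>
    also have "ln e + \<delta> * T = \<gamma> * ln e"
      unfolding \<delta>_def \<gamma>_def T_def using L\<^sub>g_pos by (simp add: field_simps)
    finally have 1: "e * growth m \<le> 1 / \<delta> * e powr \<gamma>" unfolding pw by simp
    have "ln e \<le> \<gamma> * ln e" using False e \<gamma> mult_right_mono_neg[of \<gamma> 1 "ln e"] by simp
    then have "exp (ln e) \<le> e powr \<gamma>" unfolding pw by simp
    then have 2: "h \<le> e powr \<gamma>" using e by simp
    have "decay m \<le> exp (- lam * (T - h))"
      unfolding decay_def using m(2) lam_pos by simp
    also have "\<dots> = exp (lam * h) * exp (- lam * T)" by (simp add: exp_add[symmetric] algebra_simps)
    also have "- lam * T = \<gamma> * ln e" unfolding T_def \<gamma>_def by simp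
    also have "exp (lam * h) * exp (\<gamma> * ln e) \<le> 3 * e powr \<gamma>"
    proof -
      have "exp (lam * h) \<le> exp 1" using lam_h by simp
      then have "exp (lam * h) \<le> 3" using exp_le by linarith
      then show ?thesis unfolding pw by (intro mult_right_mono) auto
    qed
    finally have 3: "decay m \<le> 3 * e powr \<gamma>" .
    have "0 \<le> 1 / lam * e powr \<gamma>" using lam_pos by simp
    then have "e * growth m + h + decay m \<le> (1 / \<delta> + 1 / lam + 4) * e powr \<gamma>"
      using 1 2 3 unfolding distrib_right by linarith
    then show ?thesis by blast
  qed
  then obtain m where "e * growth m + h + decay m \<le> (1 / \<delta> + 1 / lam + 4) * e powr \<gamma>" ..
  then have "K * (e * growth m + h + decay m) \<le> K * ((1 / \<delta> + 1 / lam + 4) * e powr \<gamma>)"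
    using K by (intro mult_left_mono) auto
  with bound[of m] show ?thesis unfolding K_def e_def \<gamma>_def \<delta>_def by (simp add: mult.assoc)
qed

end

section \<open>Constants uniform over problems and meshes\<close>

lemma scheme_intro:
  fixes \<Omega> :: "(real^'n) set"
  assumes pos: "lam > 0" "L\<^sub>g > 0" "M\<^sub>g > 0" "L\<^sub>f > 0" "M\<^sub>f > 0"
    and cp: "control_problem \<Omega> g f L\<^sub>g M\<^sub>g L\<^sub>f M\<^sub>f"
    and mf: "mesh_family \<Omega> g h\<^sub>0 \<chi>\<^sub>1 \<chi>\<^sub>2 \<K> T" and k: "k \<in> \<K>" and h: "admissible_step h\<^sub>0 lam h"
  shows "scheme (T k) k \<Omega> g f lam h L\<^sub>g M\<^sub>g L\<^sub>f M\<^sub>f"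
proof
  have h': "0 < h" "h < h\<^sub>0" "h < 1 / lam" "1 / h \<in> \<int>"
    using h unfolding admissible_step_def by auto
  note m = mf[unfolded mesh_family_def]
  have T: "k > 0" "triangulation (T k)"
    using bspec[OF conjunct1[OF m] k] by auto
  note m = conjunct2[OF m]
  have max: "Max (diameter ` T k) = k" using bspec[OF conjunct1[OF m] k] .
  note m = conjunct2[OF m]
  have step: "x + h *\<^sub>R g x a \<in> \<Union>(T k)" if "x \<in> \<Union>(T k)" "a \<in> grid h" for x a
    using bspec[OF conjunct1[OF m] k, rule_format, of h x a] h' that by auto
  have sub: "\<Union>(T k) \<subseteq> \<Omega>" using bspec[OF conjunct1[OF conjunct2[OF m]] k] .
  show "0 < k" by (rule T(1))
  show "triangulation (T k)" by (rule T(2))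
  show "\<Union>(T k) \<subseteq> \<Omega>" by (rule sub)
  show "0 < h" by (rule h'(1))
  have fin: "finite (T k)" using T(2) unfolding triangulation_def by simp
  show "diameter S \<le> k" if "S \<in> T k" for S
    using Max_ge[OF finite_imageI[OF fin] imageI[OF that], of diameter] max by simp
  show "lam * h < 1" using h'(3) pos(1) by (simp add: field_simps)
  show "bounded_lipschitz \<Omega> L\<^sub>g M\<^sub>g g" "bounded_lipschitz \<Omega> L\<^sub>f M\<^sub>f f"
    using cp unfolding control_problem_def by auto
  show "x + h *\<^sub>R g x a \<in> \<Union>(T k)" if "x \<in> \<Union>(T k)" "a \<in> grid h" for x a
    using that by (rule step)
qed (fact pos)+

lemma control_problem_trajectory:
  assumes "control_problem \<Omega> g f L\<^sub>g M\<^sub>g L\<^sub>f M\<^sub>f" "x \<in> \<Omega>" "a \<in> {0..1}" "\<alpha> \<in> controls a"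
  shows "\<exists>y. trajectory \<Omega> g x \<alpha> y"
proof -
  have "\<forall>x\<in>\<Omega>. \<forall>a\<in>{0..1}. \<forall>\<alpha>\<in>controls a. \<exists>y. trajectory \<Omega> g x \<alpha> y"
    using assms(1) unfolding control_problem_def by simp
  then show ?thesis using assms(2-4) by blast
qed

lemma control_problem_mono:
  assumes "control_problem \<Omega> g f L M\<^sub>g L\<^sub>f M\<^sub>f" "L \<le> L'"
  shows "control_problem \<Omega> g f L' M\<^sub>g L\<^sub>f M\<^sub>f"
proof -
  have "L * (norm (x - x') + \<bar>a - a'\<bar>) \<le> L' * (norm (x - x') + \<bar>a - a'\<bar>)" for x x' :: "real^'a" and a a' :: real
    using assms(2) by (intro mult_right_mono) auto
  then show ?thesis
    using assms(1) unfolding control_problem_def bounded_lipschitz_def by (meson order_trans)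
qed

text \<open>\<open>L\<close> is kept apart from \<open>L\<^sub>g\<close> so that one statement
  serves two cases: \<open>L = L\<^sub>g\<close> when \<open>lam < L\<^sub>g\<close>, and a strictly
  larger \<open>L\<close> in the critical case. The witness is an explicit expression in the
  constants, hence available before the domain, the data and the meshes are given.\<close>

lemma rate_supercritical:
  fixes lam L\<^sub>g L M\<^sub>g L\<^sub>f M\<^sub>f h\<^sub>0 \<chi>\<^sub>1 \<chi>\<^sub>2 :: real
  assumes pos: "lam > 0" "L\<^sub>g > 0" "M\<^sub>g > 0" "L\<^sub>f > 0" "M\<^sub>f > 0" and L: "lam < L" "L\<^sub>g \<le> L"
  shows "\<exists>M>0. \<forall>(\<Omega>::(real^'n) set) g f \<K> T.
    control_problem \<Omega> g f L\<^sub>g M\<^sub>g L\<^sub>f M\<^sub>f \<and> mesh_family \<Omega> g h\<^sub>0 \<chi>\<^sub>1 \<chi>\<^sub>2 \<K> T \<longrightarrow>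
      (\<forall>k\<in>\<K>. \<forall>h. admissible_step h\<^sub>0 lam h \<longrightarrow>
        (\<forall>x\<in>\<Union>(T k). \<forall>a\<in>grid h.
           \<bar>value_function \<Omega> g f lam x a - discrete_solution g f lam (T k) h (x, a)\<bar>
             \<le> M * (h + k / sqrt h) powr (lam / L)))"
proof (intro exI conjI allI impI ballI)
  let ?M = "error_const lam L M\<^sub>g L\<^sub>f M\<^sub>f * (1 / (L - lam) + 1 / lam + 4)"
  show "?M > 0"
    using L pos by (intro mult_pos_pos error_const_pos add_pos_pos divide_pos_pos) auto
  fix \<Omega> :: "(real^'n) set" and g f \<K> T k h x a
  assume A: "control_problem \<Omega> g f L\<^sub>g M\<^sub>g L\<^sub>f M\<^sub>f \<and> mesh_family \<Omega> g h\<^sub>0 \<chi>\<^sub>1 \<chi>\<^sub>2 \<K> T"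
    and k: "k \<in> \<K>" and h: "admissible_step h\<^sub>0 lam h" and x: "x \<in> \<Union>(T k)" and a: "a \<in> grid h"
  have L0: "0 < L" using pos(1) L(1) by linarith
  have cp: "control_problem \<Omega> g f L M\<^sub>g L\<^sub>f M\<^sub>f"
    by (rule control_problem_mono[OF conjunct1[OF A] L(2)])
  interpret scheme "T k" k \<Omega> g f lam h L M\<^sub>g L\<^sub>f M\<^sub>f
    by (rule scheme_intro[OF pos(1) L0 pos(3-5) cp conjunct2[OF A] k h])
  show "\<bar>value_function \<Omega> g f lam x a - discrete_solution g f lam (T k) h (x, a)\<bar>
      \<le> ?M * (h + k / sqrt h) powr (lam / L)"
  proof (rule error_supercritical[OF _ x a L(1)])
    show "\<exists>y. trajectory \<Omega> g x \<alpha> y" if "\<alpha> \<in> controls a" for \<alpha>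
      using A x D_subset that by (intro control_problem_trajectory[OF cp _ grid_01[OF a]]) auto
  qed
qed

lemma rate_subcritical:
  fixes lam L\<^sub>g M\<^sub>g L\<^sub>f M\<^sub>f h\<^sub>0 \<chi>\<^sub>1 \<chi>\<^sub>2 :: real
  assumes pos: "lam > 0" "L\<^sub>g > 0" "M\<^sub>g > 0" "L\<^sub>f > 0" "M\<^sub>f > 0" and L: "L\<^sub>g < lam"
  shows "\<exists>M>0. \<forall>(\<Omega>::(real^'n) set) g f \<K> T.
    control_problem \<Omega> g f L\<^sub>g M\<^sub>g L\<^sub>f M\<^sub>f \<and> mesh_family \<Omega> g h\<^sub>0 \<chi>\<^sub>1 \<chi>\<^sub>2 \<K> T \<longrightarrow>
      (\<forall>k\<in>\<K>. \<forall>h. admissible_step h\<^sub>0 lam h \<longrightarrow>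
        (\<forall>x\<in>\<Union>(T k). \<forall>a\<in>grid h.
           \<bar>value_function \<Omega> g f lam x a - discrete_solution g f lam (T k) h (x, a)\<bar>
             \<le> M * (h + k / sqrt h)))"
proof (intro exI conjI allI impI ballI)
  let ?M = "error_const lam L\<^sub>g M\<^sub>g L\<^sub>f M\<^sub>f * (2 / (lam - L\<^sub>g) + 1)"
  show "?M > 0"
    using L pos by (intro mult_pos_pos error_const_pos add_pos_pos divide_pos_pos) auto
  fix \<Omega> :: "(real^'n) set" and g f \<K> T k h x a
  assume A: "control_problem \<Omega> g f L\<^sub>g M\<^sub>g L\<^sub>f M\<^sub>f \<and> mesh_family \<Omega> g h\<^sub>0 \<chi>\<^sub>1 \<chi>\<^sub>2 \<K> T"
    and k: "k \<in> \<K>" and h: "admissible_step h\<^sub>0 lam h" and x: "x \<in> \<Union>(T k)" and a: "a \<in> grid h"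
  interpret scheme "T k" k \<Omega> g f lam h L\<^sub>g M\<^sub>g L\<^sub>f M\<^sub>f
    by (rule scheme_intro[OF pos conjunct1[OF A] conjunct2[OF A] k h])
  show "\<bar>value_function \<Omega> g f lam x a - discrete_solution g f lam (T k) h (x, a)\<bar>
      \<le> ?M * (h + k / sqrt h)"
  proof (rule error_subcritical[OF _ x a L])
    show "\<exists>y. trajectory \<Omega> g x \<alpha> y" if "\<alpha> \<in> controls a" for \<alpha>
      using A x D_subset that by (intro control_problem_trajectory[OF conjunct1[OF A] _ grid_01[OF a]]) auto
  qed
qed

theorem theorem3p1:
  fixes lam L\<^sub>g M\<^sub>g L\<^sub>f M\<^sub>f h\<^sub>0 \<chi>\<^sub>1 \<chi>\<^sub>2 :: real
  assumes "lam > 0" and "L\<^sub>g > 0" and "M\<^sub>g > 0" and "L\<^sub>f > 0" and "M\<^sub>f > 0"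
    and "h\<^sub>0 > 0" and "\<chi>\<^sub>1 > 0"
  shows "(L\<^sub>g < lam \<longrightarrow>
        (\<exists>M>0. \<forall>(\<Omega>::(real^'n) set) g f \<K> T.
           control_problem \<Omega> g f L\<^sub>g M\<^sub>g L\<^sub>f M\<^sub>f \<and> mesh_family \<Omega> g h\<^sub>0 \<chi>\<^sub>1 \<chi>\<^sub>2 \<K> T \<longrightarrow>
             (\<forall>k\<in>\<K>. \<forall>h. admissible_step h\<^sub>0 lam h \<longrightarrow>
               (\<forall>x\<in>\<Union>(T k). \<forall>a\<in>grid h.
                  \<bar>value_function \<Omega> g f lam x a - discrete_solution g f lam (T k) h (x, a)\<bar>
                    \<le> M * (h + k / sqrt h))))) \<and>
    (L\<^sub>g > lam \<longrightarrow>
        (\<exists>M>0. \<forall>(\<Omega>::(real^'n) set) g f \<K> T.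
           control_problem \<Omega> g f L\<^sub>g M\<^sub>g L\<^sub>f M\<^sub>f \<and> mesh_family \<Omega> g h\<^sub>0 \<chi>\<^sub>1 \<chi>\<^sub>2 \<K> T \<longrightarrow>
             (\<forall>k\<in>\<K>. \<forall>h. admissible_step h\<^sub>0 lam h \<longrightarrow>
               (\<forall>x\<in>\<Union>(T k). \<forall>a\<in>grid h.
                  \<bar>value_function \<Omega> g f lam x a - discrete_solution g f lam (T k) h (x, a)\<bar>
                    \<le> M * (h + k / sqrt h) powr (lam / L\<^sub>g))))) \<and>
    (L\<^sub>g = lam \<longrightarrow> (\<forall>\<gamma>. 0 < \<gamma> \<and> \<gamma> < 1 \<longrightarrow>
        (\<exists>M>0. \<forall>(\<Omega>::(real^'n) set) g f \<K> T.
           control_problem \<Omega> g f L\<^sub>g M\<^sub>g L\<^sub>f M\<^sub>f \<and> mesh_family \<Omega> g h\<^sub>0 \<chi>\<^sub>1 \<chi>\<^sub>2 \<K> T \<longrightarrow>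
             (\<forall>k\<in>\<K>. \<forall>h. admissible_step h\<^sub>0 lam h \<longrightarrow>
               (\<forall>x\<in>\<Union>(T k). \<forall>a\<in>grid h.
                  \<bar>value_function \<Omega> g f lam x a - discrete_solution g f lam (T k) h (x, a)\<bar>
                    \<le> M * (h + k / sqrt h) powr \<gamma>)))))"
proof (intro conjI impI allI, goal_cases)
  case 1
  then show ?case by (rule rate_subcritical[OF assms(1-5)])
next
  case 2
  then show ?case by (rule rate_supercritical[OF assms(1-5) _ order_refl])
next
  case (3 \<gamma>)
  have "lam < lam / \<gamma>" using 3 assms(1) by (simp add: field_simps)
  moreover from this have "L\<^sub>g \<le> lam / \<gamma>" using 3 by simp
  moreover have \<gamma>: "lam / (lam / \<gamma>) = \<gamma>" using assms(1) by simp
  ultimately show ?case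
    using rate_supercritical[OF assms(1-5), of "lam / \<gamma>", where 'n = 'n] unfolding \<gamma> by blast
qed

end
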